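(* Let $\alpha>-1$, $1<p\le q<\infty$ and $0\le\gamma<2+\alpha$. Let $\Phi\in B_p$ and let $\Psi$ be its complementary function. Let $\omega$ be a weight and $\mu$ a positive Borel measure on $\mathcal H$ such that for some $C>0$ and every interval $I\subset\mathbb R$, $$|Q_I|_\alpha^{q(\frac{\gamma}{2+\alpha}-\frac1p)}\,\|\omega^{-1}\|_{Q_I,\Psi,\alpha}^q\,\mu(Q_I)\le C.$$ Then there is $K>0$ such that for every $f\in L^p(\mathcal H,\omega dV_\alpha)$, $$\left(\int_{\mathcal H}(\mathcal M_{\alpha,\gamma}f)^q\,d\mu\right)^{1/q}\le K\|f\omega\|_{p,\alpha}.$$
   Context: $\mathcal H=\{x+iy:x\in\mathbb R,\ y>0\}$; for $\alpha>-1$, $dV_\alpha(x+iy)=y^\alpha dx\,dy$; $\|g\|_{p,\alpha}=(\int_{\mathcal H}|g|^pdV_\alpha)^{1/p}$. A weight is a nonnegative locally integrable function. For an interval $I$, $Q_I=\{x+iy:x\in I,0<y<|I|\}$, $|Q_I|_\alpha=\int_{Q_I}dV_\alpha$. $\mathcal M_{\alpha,\gamma}f(z)=\sup\{|I|^{-(2+\alpha-\gamma)}\int_{Q_I}|f|dV_\alpha: I\subset\mathbb R\text{ interval}, z\in Q_I\}$. A Young function is a continuous convex increasing $\Phi:[0,\infty)\to[0,\infty)$ with $\Phi(0)=0$ and $\Phi(t)\to\infty$ as $t\to\infty$. Its complementary function is $\Psi(s)=\sup_{t\ge0}(ts-\Phi(t))$. The Luxemburg norm is $\|f\|_{Q_I,\Phi,\alpha}=\inf\{\lambda>0:\frac1{|Q_I|_\alpha}\int_{Q_I}\Phi(|f|/\lambda)dV_\alpha\le1\}$.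 For $1<p<\infty$, $\Phi\in B_p$ means $\Phi$ satisfies the $\Delta_2$ condition (there is $K>1$ with $\Phi(2t)\le K\Phi(t)$ for all $t\ge0$) and $\int_c^\infty\frac{\Phi(t)}{t^p}\frac{dt}{t}<\infty$ for some $c>0$. *)

theory Defs
  imports "HOL-Analysis.Analysis"
begin

definition UHP :: "complex set" where
  "UHP = {z. Im z > 0}"

definition dV :: "real \<Rightarrow> complex measure" where
  "dV \<alpha> = density lebesgue (\<lambda>z. indicator UHP z * ennreal (Im z powr \<alpha>))"

(* real power of an extended nonnegative real, for positive exponents; top^r = top *)
definition enn_powr :: "ennreal \<Rightarrow> real \<Rightarrow> ennreal" where
  "enn_powr x r = (if x = top then top else ennreal (enn2real x powr r))"

definition is_real_interval :: "real set \<Rightarrow> bool" where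
  "is_real_interval I \<longleftrightarrow> is_interval I \<and> bounded I \<and> (\<exists>a b. a \<in> I \<and> b \<in> I \<and> a < b)"

definition ilen :: "real set \<Rightarrow> real" where
  "ilen I = Sup I - Inf I"

definition Qbox :: "real set \<Rightarrow> complex set" where
  "Qbox I = {z. Re z \<in> I \<and> 0 < Im z \<and> Im z < ilen I}"

definition Qvol :: "real \<Rightarrow> real set \<Rightarrow> real" where
  "Qvol \<alpha> I = measure (dV \<alpha>) (Qbox I)"

definition frac_max :: "real \<Rightarrow> real \<Rightarrow> (complex \<Rightarrow> complex) \<Rightarrow> complex \<Rightarrow> ennreal" where
  "frac_max \<alpha> \<gamma> f z =
     (SUP I \<in> {I. is_real_interval I \<and> z \<in> Qbox I}.
        ennreal (ilen I powr (-(2 + \<alpha> - \<gamma>))) *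
        set_nn_integral (dV \<alpha>) (Qbox I) (\<lambda>w. ennreal (cmod (f w))))"

definition young_function :: "(real \<Rightarrow> real) \<Rightarrow> bool" where
  "young_function \<Phi> \<longleftrightarrow> continuous_on {0..} \<Phi> \<and> convex_on {0..} \<Phi> \<and> mono_on {0..} \<Phi>
      \<and> \<Phi> 0 = 0 \<and> (\<forall>t\<ge>0. \<Phi> t \<ge> 0) \<and> filterlim \<Phi> at_top at_top"

definition Delta2 :: "(real \<Rightarrow> real) \<Rightarrow> bool" where
  "Delta2 \<Phi> \<longleftrightarrow> (\<exists>K>1. \<forall>t\<ge>0. \<Phi> (2 * t) \<le> K * \<Phi> t)"

definition Bp_class :: "real \<Rightarrow> (real \<Rightarrow> real) \<Rightarrow> bool" where
  "Bp_class p \<Phi> \<longleftrightarrow> young_function \<Phi> \<and> Delta2 \<Phi> \<and>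
     (\<exists>c>0. set_nn_integral lborel {c..} (\<lambda>t. ennreal ((\<Phi> t / t powr p) / t)) < \<infinity>)"

definition complementary :: "(real \<Rightarrow> real) \<Rightarrow> real \<Rightarrow> ennreal" where
  "complementary \<Phi> s = (SUP t \<in> {0..}. ennreal (t * s - \<Phi> t))"

definition young_ext :: "(real \<Rightarrow> ennreal) \<Rightarrow> ennreal \<Rightarrow> ennreal" where
  "young_ext F x = (if x = top then top else F (enn2real x))"

(* Luxemburg norm ||g||_{Q_I,F,alpha} of a [0,inf]-valued function g (inf of empty set = inf) *)
definition luxemburg :: "(ennreal \<Rightarrow> ennreal) \<Rightarrow> real \<Rightarrow> real set \<Rightarrow> (complex \<Rightarrow> ennreal) \<Rightarrow> ennreal" where
  "luxemburg F \<alpha> I g = Inf {ennreal r | r. r > 0 \<and>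
      ennreal (1 / Qvol \<alpha> I) * set_nn_integral (dV \<alpha>) (Qbox I) (\<lambda>z. F (g z / ennreal r)) \<le> 1}"

definition weight :: "(complex \<Rightarrow> real) \<Rightarrow> bool" where
  "weight \<omega> \<longleftrightarrow> (\<forall>z. \<omega> z \<ge> 0) \<and>
     (\<forall>K. compact K \<and> K \<subseteq> UHP \<longrightarrow> set_integrable lebesgue K \<omega>)"

end

(*
  The maximal function is dominated by the boxes over the intervals [m 2^k, (m + 2) 2^k), because every
  interval lies in one of these of comparable length. No stopping time is needed: the q-th power of
  the supremum over these boxes is at most the sum of the q-th powers. Hoelder's inequality for the
  pair Phi, Psi and the testing condition bound each term, after integration against mu, by a
  constant times (|Q|_alpha N_Q^p)^(q/p), where N_Q is the Luxemburg norm of f omega on Q. Since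
  q >= p it remains to bound the sum of |Q|_alpha N_Q^p over all boxes by the p-th power of the norm
  of f omega. Cutting into the level sets N_Q > 2^l, a covering argument bounds the total volume of
  the boxes of each level (the sum over nested boxes converges geometrically because alpha > -1),
  and the B_p integral controls the sum over l.
*)
theory Submission
  imports Defs
begin

section \<open>Boxes over overlapping dyadic intervals\<close>

text \<open>The boxes overlap at every scale, so integrals over them cannot simply be added; a
  Carleson packing bound replaces disjointness. About 2^j boxes lie j generations below a given one,
  each smaller in volume by the factor 2^(-j(2+\<alpha>)), so that generation has relative volume
  about 2^(-j(1+\<alpha>)). All boxes of a level are thus counted at the price of a disjoint
  selection. The B_p integral controls Phi only away from 0, while the sum of 2^(lp) Phi(t/2^l) over
  all large l may diverge. Convexity supplies eps > 0 with Phi(eps) at most 1/2: the points of a box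
  where f omega is at most eps 2^l contribute at most half of its volume to the integral of Phi(f
  omega/2^l), so they can be discarded and only the levels with 2^l < t/eps remain. What is left is
  a Riemann sum for t^p times the integral of Phi(s)/s^(p+1) over s >= eps. The exponent in the
  testing condition is exactly what remains of |Q|^(q gamma/(2+\<alpha>)) once |Q|^(q/p) has been
  set aside for the embedding sum, which is raised to the power q/p.\<close>

definition grid_interval :: "int \<times> int \<Rightarrow> real set" where
  "grid_interval i = {of_int (snd i) * 2 powr of_int (fst i) ..< (of_int (snd i) + 2) * 2 powr of_int (fst i)}"

abbreviation grid_box :: "int \<times> int \<Rightarrow> complex set" where
  "grid_box i \<equiv> Qbox (grid_interval i)"

lemma ilen_grid_interval: "ilen (grid_interval i) = 2 powr (of_int (fst i) + 1)"
proof -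
  have "of_int (snd i) * 2 powr of_int (fst i) < (of_int (snd i) + 2) * (2::real) powr of_int (fst i)"
    by (intro mult_strict_right_mono) auto
  then show ?thesis
    unfolding ilen_def grid_interval_def
    by (simp add: cSup_atLeastLessThan cInf_atLeastLessThan algebra_simps powr_add)
qed

lemma is_real_interval_grid_interval: "is_real_interval (grid_interval i)"
proof -
  let ?a = "of_int (snd i) * 2 powr of_int (fst i)::real"
  let ?b = "(of_int (snd i) + 1) * 2 powr of_int (fst i)::real"
  have "?a < ?b" "?b < (of_int (snd i) + 2) * 2 powr of_int (fst i)"
    by (intro mult_strict_right_mono; simp)+
  then have "?a \<in> grid_interval i \<and> ?b \<in> grid_interval i \<and> ?a < ?b"
    by (auto simp: grid_interval_def)
  then show ?thesis
    unfolding is_real_interval_def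
    by (metis grid_interval_def is_interval_co bounded_subset bounded_closed_interval atLeastLessThan_subseteq_atLeastAtMost_iff order_refl)
qed

text \<open>A length of two units makes a single grid suffice. Let \<open>2 powr k\<close> be the
  least power of two not below the length of \<open>I\<close>, and \<open>m * 2 powr k\<close> the
  last grid point not beyond its left end; then \<open>I\<close> ends before
  \<open>(m + 2) * 2 powr k\<close>. Rounding up to a power of two and taking two units cost a
  factor 2 each, hence the 4.\<close>

lemma grid_interval_covers:
  assumes "is_real_interval I"
  obtains i where "I \<subseteq> grid_interval i" "ilen I \<le> ilen (grid_interval i)"
    "ilen (grid_interval i) \<le> 4 * ilen I" "0 < ilen I"
proof -
  obtain a b where ab: "a \<in> I" "b \<in> I" "a < b" and bd: "bounded I"
    using assms by (auto simp: is_real_interval_def)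
  have bda: "bdd_above I" "bdd_below I"
    using bd by (auto simp: bounded_imp_bdd_above bounded_imp_bdd_below)
  have "Inf I \<le> a" "b \<le> Sup I"
    using bda ab by (auto intro: cInf_lower cSup_upper)
  then have d: "0 < ilen I" using ab by (simp add: ilen_def)
  define k where "k = \<lceil>log 2 (ilen I)\<rceil>"
  define m where "m = \<lfloor>Inf I / 2 powr of_int k\<rfloor>"
  have dk: "ilen I \<le> 2 powr of_int k"
    using d by (simp add: k_def le_powr_iff)
  have kd: "2 powr of_int k \<le> 2 * ilen I"
  proof -
    have "of_int k \<le> log 2 (ilen I) + 1" unfolding k_def by linarith
    then have "2 powr of_int k \<le> 2 powr (log 2 (ilen I) + 1)" by simp
    also have "\<dots> = 2 * ilen I" using d by (simp add: powr_add)
    finally show ?thesis .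
  qed
  have m1: "of_int m * 2 powr of_int k \<le> Inf I"
    unfolding m_def by (simp flip: pos_le_divide_eq)
  have m2: "Inf I < (of_int m + 1) * 2 powr of_int k"
    unfolding m_def by (simp flip: pos_divide_less_eq)
  have "I \<subseteq> grid_interval (k, m)"
  proof
    fix x assume "x \<in> I"
    then have "Inf I \<le> x" "x \<le> Sup I" using bda by (auto intro: cInf_lower cSup_upper)
    then show "x \<in> grid_interval (k, m)"
      using m1 m2 dk by (auto simp: grid_interval_def ilen_def algebra_simps)
  qed
  moreover have "ilen (grid_interval (k, m)) = 2 * 2 powr of_int k"
    by (simp add: ilen_grid_interval powr_add)
  ultimately show thesis using that dk kd d by fastforce
qed

lemma borel_measurable_Qbox [measurable]:
  assumes [measurable]: "I \<in> sets borel"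
  shows "Qbox I \<in> sets borel"
  unfolding Qbox_def by measurable

lemma grid_interval_borel [measurable]: "grid_interval i \<in> sets borel"
  by (simp add: grid_interval_def)

lemma sets_dV [simp, measurable_cong]: "sets (dV \<alpha>) = sets lebesgue"
  by (simp add: dV_def)

lemma space_dV [simp]: "space (dV \<alpha>) = UNIV"
  by (simp add: dV_def)

lemma grid_box_sets_dV [measurable]: "grid_box i \<in> sets (dV \<alpha>)"
  using borel_measurable_Qbox[OF grid_interval_borel, of i] by auto

lemma Qbox_mono:
  "I \<subseteq> J \<Longrightarrow> ilen I \<le> ilen J \<Longrightarrow> Qbox I \<subseteq> Qbox J"
  by (auto simp: Qbox_def)

section \<open>Weighted volume of the boxes\<close>

lemma measurable_Complex_pair [measurable]:
  "(\<lambda>(x, y). Complex x y) \<in> borel_measurable (lborel \<Otimes>\<^sub>M lborel)"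
proof -
  have "(\<lambda>p. Complex (fst p) (snd p)) \<in> borel_measurable borel"
    unfolding Complex_eq by (intro borel_measurable_continuous_onI continuous_intros)
  moreover have "borel_measurable (lborel \<Otimes>\<^sub>M lborel) = (borel_measurable borel :: (real \<times> real \<Rightarrow> complex) set)"
    unfolding lborel_prod by (intro measurable_cong_sets) auto
  ultimately show ?thesis unfolding case_prod_unfold by blast
qed

text \<open>Lebesgue measure is determined by its values on open boxes, and a box in the plane is a
  product of two intervals. In this form Tonelli applies to the density of \<open>dV\<close>, which
  depends on \<open>Im z\<close> alone.\<close>

lemma lborel_complex_eq:
  "(lborel :: complex measure) = distr (lborel \<Otimes>\<^sub>M lborel) borel (\<lambda>(x, y). Complex x y)"
proof (rule lborel_eqI)
  fix l u :: complex
  assume le: "\<And>b. b \<in> Basis \<Longrightarrow> l \<bullet> b \<le> u \<bullet> b"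
  have lu: "Re l \<le> Re u" "Im l \<le> Im u"
    using le[of 1] le[of \<i>] by (auto simp: Basis_complex_def inner_complex_def)
  have "(\<lambda>(x, y). Complex x y) -` box l u \<inter> space (lborel \<Otimes>\<^sub>M lborel)
     = {Re l<..<Re u} \<times> {Im l<..<Im u}"
    by (auto simp: box_def Basis_complex_def inner_complex_def space_pair_measure)
  then have "emeasure (distr (lborel \<Otimes>\<^sub>M lborel) borel (\<lambda>(x, y). Complex x y)) (box l u)
     = ennreal (Re u - Re l) * ennreal (Im u - Im l)"
    using lu measurable_Complex_pair by (simp add: emeasure_distr lborel.emeasure_pair_measure_Times)
  also have "\<dots> = ennreal (\<Prod>b\<in>Basis. (u - l) \<bullet> b)"
    using lu by (simp add: Basis_complex_def inner_complex_def ennreal_mult)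
  finally show "emeasure (distr (lborel \<Otimes>\<^sub>M lborel) borel (\<lambda>(x, y). Complex x y)) (box l u)
     = ennreal (\<Prod>b\<in>Basis. (u - l) \<bullet> b)" .
qed auto

lemma emeasure_dV_Qbox_atLeastLessThan:
  assumes \<alpha>: "\<alpha> > -1" and ab: "a < b"
  shows "emeasure (dV \<alpha>) (Qbox {a..<b}) = ennreal ((b - a) powr (2 + \<alpha>) / (1 + \<alpha>))"
proof -
  define d where "d = b - a"
  have d: "d > 0" "ilen {a..<b} = d" using ab by (auto simp: d_def ilen_def)
  have [measurable]: "Qbox {a..<b} \<in> sets borel" by measurable
  have [measurable]: "UHP \<in> sets borel" unfolding UHP_def by measurable
  have B: "(\<lambda>z. indicator UHP z * ennreal (Im z powr \<alpha>)) \<in> borel_measurable borel"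
    by measurable
  have "emeasure (dV \<alpha>) (Qbox {a..<b})
      = (\<integral>\<^sup>+z. indicator UHP z * ennreal (Im z powr \<alpha>) * indicator (Qbox {a..<b}) z \<partial>lebesgue)"
    unfolding dV_def using B by (subst emeasure_density) (auto intro: measurable_completion)
  also have "\<dots> = (\<integral>\<^sup>+z. indicator {a..<b} (Re z) * (ennreal (Im z powr \<alpha>) * indicator {0<..<d} (Im z)) \<partial>lborel)"
    unfolding nn_integral_completion
    by (intro nn_integral_cong) (auto simp: indicator_def Qbox_def UHP_def d)
  also have "\<dots> = (\<integral>\<^sup>+(x,y). indicator {a..<b} x * (ennreal (y powr \<alpha>) * indicator {0<..<d} y) \<partial>(lborel \<Otimes>\<^sub>M lborel))"
    unfolding lborel_complex_eq
    by (subst nn_integral_distr[OF measurable_Complex_pair]) (auto simp: split_beta intro!: nn_integral_cong)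
  also have "\<dots> = (\<integral>\<^sup>+x. (\<integral>\<^sup>+y. indicator {a..<b} x * (ennreal (y powr \<alpha>) * indicator {0<..<d} y) \<partial>lborel) \<partial>lborel)"
    by (subst lborel.nn_integral_fst[symmetric]) auto
  also have "\<dots> = (\<integral>\<^sup>+x. indicator {a..<b} x * (\<integral>\<^sup>+y. (ennreal (y powr \<alpha>) * indicator {0<..<d} y) \<partial>lborel) \<partial>lborel)"
    by (subst nn_integral_cmult) auto
  \<comment> \<open>The two endpoints are null; the known integral of a power from 0 is stated on
    the closed interval. Its convergence at 0 is where \<alpha> > -1 enters.\<close>
  also have "(\<integral>\<^sup>+y. (ennreal (y powr \<alpha>) * indicator {0<..<d} y) \<partial>lborel)
      = (\<integral>\<^sup>+y. (ennreal (y powr \<alpha>) * indicator {0..d} y) \<partial>lborel)"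
    by (intro nn_integral_cong_AE)
      (use AE_lborel_singleton[of 0] AE_lborel_singleton[of d] in eventually_elim, auto simp: indicator_def)
  also have "\<dots> = ennreal (d powr (\<alpha> + 1) / (\<alpha> + 1))"
    using has_integral_powr_from_0[OF \<alpha>, of d] d by (intro nn_integral_has_integral_lebesgue') auto
  also have "(\<integral>\<^sup>+x. indicator {a..<b} x * ennreal (d powr (\<alpha> + 1) / (\<alpha> + 1)) \<partial>lborel)
     = ennreal d * ennreal (d powr (\<alpha> + 1) / (\<alpha> + 1))"
    using ab by (subst nn_integral_multc) (auto simp: d_def)
  also have "\<dots> = ennreal (d powr (2 + \<alpha>) / (1 + \<alpha>))"
    using d \<alpha> by (subst ennreal_mult[symmetric]) (auto simp: powr_add add.commute power2_eq_square)
  finally show ?thesis unfolding d_def .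
qed

text \<open>The volume of a box of side \<open>2 powr (fst i + 1)\<close> in closed form. It depends
  on the scale only, so volumes of one generation are summed by counting.\<close>

definition grid_vol :: "real \<Rightarrow> int \<times> int \<Rightarrow> real" where
  "grid_vol \<alpha> i = 2 powr ((of_int (fst i) + 1) * (2 + \<alpha>)) / (1 + \<alpha>)"

lemma grid_vol_pos: "\<alpha> > -1 \<Longrightarrow> grid_vol \<alpha> i > 0"
  by (simp add: grid_vol_def)

lemma emeasure_grid_box:
  assumes "\<alpha> > -1"
  shows "emeasure (dV \<alpha>) (grid_box i) = ennreal (grid_vol \<alpha> i)"
proof -
  have "of_int (snd i) * 2 powr of_int (fst i) < (of_int (snd i) + 2) * (2::real) powr of_int (fst i)"
    by (intro mult_strict_right_mono) auto
  from emeasure_dV_Qbox_atLeastLessThan[OF assms this] show ?thesis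
    unfolding grid_interval_def grid_vol_def powr_powr[symmetric]
    by (simp add: powr_add algebra_simps)
qed

lemma Qvol_grid_interval: "\<alpha> > -1 \<Longrightarrow> Qvol \<alpha> (grid_interval i) = grid_vol \<alpha> i"
  unfolding Qvol_def measure_def
  by (simp add: emeasure_grid_box grid_vol_pos less_imp_le)

section \<open>Packing and covering\<close>

lemma grid_vol_shift:
  "grid_vol \<alpha> (k - j, m) = grid_vol \<alpha> (k, m') * 2 powr (- of_int j * (2 + \<alpha>))"
  by (simp add: grid_vol_def powr_add[symmetric] algebra_simps)

lemma grid_interval_meets_bounds:
  assumes "grid_interval (k - int j, m) \<inter> grid_interval (k, n) \<noteq> {}"
  shows "m \<in> {n * 2 ^ j - 1 ..< (n + 2) * 2 ^ j}"
proof -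
  define e where "e = (2::real) powr of_int (k - int j)"
  have e: "e > 0" by (simp add: e_def)
  have ek: "2 powr of_int k = e * 2 ^ j"
    by (simp add: e_def powr_diff powr_realpow)
  obtain y where "y \<in> grid_interval (k - int j, m)" "y \<in> grid_interval (k, n)"
    using assms by blast
  then obtain x where x: "of_int m * e \<le> x" "x < (of_int m + 2) * e"
     "of_int n * (e * 2 ^ j) \<le> x" "x < (of_int n + 2) * (e * 2 ^ j)"
    unfolding grid_interval_def fst_conv snd_conv ek atLeastLessThan_iff e_def[symmetric] by blast
  have "of_int m * e < (of_int n + 2) * 2 ^ j * e" "of_int n * 2 ^ j * e < (of_int m + 2) * e"
    using x by (auto simp: algebra_simps)
  then have "real_of_int m < (of_int n + 2) * 2 ^ j" "of_int n * 2 ^ j < real_of_int m + 2"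
    using e by auto
  then have "real_of_int m < of_int ((n + 2) * 2 ^ j)" "real_of_int (n * 2 ^ j) < of_int (m + 2)"
    \<comment> \<open>Over the integers, n * 2^j < m + 2 means that m is at least n * 2^j - 1. This
      leaves 2 * 2^j + 1 possible positions for \<open>m\<close>.\<close>
    by simp_all
  then show ?thesis unfolding of_int_less_iff by auto
qed

text \<open>Three times the sum of the geometric series with ratio
  \<open>2 powr (-(1 + \<alpha>))\<close>; the 3 comes from bounding the 2 * 2^j + 1 positions in
  generation j by 3 * 2^j.\<close>

definition packing_const :: "real \<Rightarrow> real" where
  "packing_const \<alpha> = 3 / (1 - 2 powr (-(1 + \<alpha>)))"

lemma packing_const_pos: "\<alpha> > -1 \<Longrightarrow> packing_const \<alpha> > 0"
  by (simp add: packing_const_def powr_less_one)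

text \<open>In generation j below \<open>i0\<close> at most 3 * 2^j intervals meet that of
  \<open>i0\<close>, and each box has the volume of \<open>i0\<close> times 2^(-j(2+\<alpha>)). The
  generations therefore form a geometric series, convergent because \<alpha> > -1.\<close>

lemma grid_packing:
  assumes \<alpha>: "\<alpha> > -1" and F: "finite F"
    and le: "\<And>i. i \<in> F \<Longrightarrow> fst i \<le> fst i0"
    and meet: "\<And>i. i \<in> F \<Longrightarrow> grid_interval i \<inter> grid_interval i0 \<noteq> {}"
  shows "(\<Sum>i\<in>F. grid_vol \<alpha> i) \<le> packing_const \<alpha> * grid_vol \<alpha> i0"
proof -
  obtain k n where i0: "i0 = (k, n)" by fastforce
  \<comment> \<open>Depth of the finest scale occurring in \<open>F\<close>; the inserted 0 keeps
    the maximum meaningful for empty \<open>F\<close>.\<close>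
  define N where "N = nat (Max (insert 0 ((\<lambda>i. k - fst i) ` F)))"
  define M where "M j = {n * 2 ^ j - 1 ..< (n + 2) * 2 ^ j}" for j :: nat
  define r where "r = (2::real) powr (-(1 + \<alpha>))"
  have r: "0 < r" "r < 1" using \<alpha> by (auto simp: r_def powr_less_one)
  have sub: "F \<subseteq> (\<lambda>(j, m). (k - int j, m)) ` (SIGMA j:{..N}. M j)"
  proof
    fix i assume i: "i \<in> F"
    define j where "j = nat (k - fst i)"
    have ij: "i = (k - int j, snd i)" using le[OF i] by (simp add: j_def i0 prod_eq_iff)
    have "k - fst i \<le> Max (insert 0 ((\<lambda>i. k - fst i) ` F))" using F i by (intro Max_ge) auto
    then have "j \<le> N" by (auto simp: j_def N_def)
    moreover have "snd i \<in> M j"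
      using grid_interval_meets_bounds[of k j "snd i" n] meet[OF i] ij i0 by (simp add: M_def)
    ultimately show "i \<in> (\<lambda>(j, m). (k - int j, m)) ` (SIGMA j:{..N}. M j)"
      using ij by (intro image_eqI[of _ _ "(j, snd i)"]) auto
  qed
  have inj: "inj_on (\<lambda>(j, m). (k - int j, m)) (SIGMA j:{..N}. M j)"
    by (auto simp: inj_on_def)
  have "(\<Sum>i\<in>F. grid_vol \<alpha> i) \<le> (\<Sum>i\<in>(\<lambda>(j, m). (k - int j, m)) ` (SIGMA j:{..N}. M j). grid_vol \<alpha> i)"
    by (intro sum_mono2 sub finite_imageI finite_SigmaI)
      (use \<alpha> in \<open>auto simp: M_def less_imp_le grid_vol_pos\<close>)
  also have "\<dots> = (\<Sum>j\<le>N. \<Sum>m\<in>M j. grid_vol \<alpha> (k - int j, m))"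
    by (subst sum.reindex[OF inj], subst sum.Sigma) (auto simp: M_def split_beta)
  also have "\<dots> \<le> (\<Sum>j\<le>N. 3 * grid_vol \<alpha> i0 * r ^ j)"
  proof (rule sum_mono)
    fix j
    have "(\<Sum>m\<in>M j. grid_vol \<alpha> (k - int j, m)) = real (card (M j)) * (grid_vol \<alpha> i0 * 2 powr (- of_int (int j) * (2 + \<alpha>)))"
      unfolding grid_vol_shift[of \<alpha> k "int j" _ n] i0 by simp
    also have "\<dots> \<le> (3 * 2 ^ j) * (grid_vol \<alpha> i0 * 2 powr (- of_int (int j) * (2 + \<alpha>)))"
    proof (intro mult_right_mono)
      have "int (card (M j)) = 2 * 2 ^ j + 1" by (simp add: M_def algebra_simps)
      also have "\<dots> \<le> 3 * 2 ^ j" by simp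
      finally have "real_of_int (int (card (M j))) \<le> real_of_int (3 * 2 ^ j)" by (simp only: of_int_le_iff)
      then show "real (card (M j)) \<le> 3 * 2 ^ j" by simp
    qed (use \<alpha> in \<open>auto simp: less_imp_le grid_vol_pos\<close>)
    also have "\<dots> = 3 * grid_vol \<alpha> i0 * r ^ j"
      by (simp add: r_def powr_realpow[symmetric] powr_powr powr_add[symmetric] algebra_simps)
    finally show "(\<Sum>m\<in>M j. grid_vol \<alpha> (k - int j, m)) \<le> 3 * grid_vol \<alpha> i0 * r ^ j" .
  qed
  also have "\<dots> = 3 * grid_vol \<alpha> i0 * (\<Sum>j\<le>N. r ^ j)" by (simp add: sum_distrib_left)
  also have "\<dots> \<le> 3 * grid_vol \<alpha> i0 * (1 / (1 - r))"
    using r \<alpha> by (intro mult_left_mono)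
      (auto simp: less_imp_le grid_vol_pos sum_gp0 intro!: divide_right_mono)
  finally show ?thesis by (simp add: packing_const_def r_def)
qed

text \<open>The left side counts overlapping boxes with multiplicity. By \<open>grid_packing\<close>
  a cluster of boxes meeting a largest one has total volume at most a fixed multiple of the volume
  of that one, and the integral of \<open>h\<close> over that one box pays for the cluster. The
  largest boxes chosen in turn are disjoint, so these payments add up to a single integral.\<close>

lemma grid_vitali:
  assumes \<alpha>: "\<alpha> > -1" and h [measurable]: "h \<in> borel_measurable (dV \<alpha>)"
    and "finite F"
    and "\<And>i. i \<in> F \<Longrightarrow> ennreal (grid_vol \<alpha> i) \<le> 2 * (\<integral>\<^sup>+z\<in>grid_box i. h z \<partial>dV \<alpha>)"
  shows "ennreal (\<Sum>i\<in>F. grid_vol \<alpha> i)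
    \<le> ennreal (2 * packing_const \<alpha>) * (\<integral>\<^sup>+z\<in>(\<Union>i\<in>F. grid_box i). h z \<partial>dV \<alpha>)"
  using assms(3,4)
proof (induction "card F" arbitrary: F rule: less_induct)
  case less
  show ?case
  proof (cases "F = {}")
    case True
    then show ?thesis by simp
  next
    case False
    \<comment> \<open>Remove a largest box together with all boxes whose intervals meet its interval; the rest is disjoint from it.\<close>
    define k where "k = Max (fst ` F)"
    have "k \<in> fst ` F" using False less.prems unfolding k_def by (intro Max_in) auto
    then obtain i0 where i0: "i0 \<in> F" "fst i0 = k" by auto
    have max: "fst i \<le> fst i0" if "i \<in> F" for i
      using that less.prems i0 by (auto simp: k_def)
    define G where "G = {i \<in> F. grid_interval i \<inter> grid_interval i0 \<noteq> {}}"
    define H where "H = F - G"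
    have fin: "finite G" "finite H" using less.prems by (auto simp: G_def H_def)
    have "i0 \<in> G" using i0 is_real_interval_grid_interval[of i0] by (auto simp: G_def is_real_interval_def)
    then have "H \<subset> F" using i0 by (auto simp: H_def)
    then have "card H < card F" using less.prems by (intro psubset_card_mono) auto
    from less.hyps[OF this fin(2)] less.prems
    have IH: "ennreal (\<Sum>i\<in>H. grid_vol \<alpha> i)
      \<le> ennreal (2 * packing_const \<alpha>) * (\<integral>\<^sup>+z\<in>(\<Union>i\<in>H. grid_box i). h z \<partial>dV \<alpha>)"
      by (auto simp: H_def)
    have "(\<Sum>i\<in>G. grid_vol \<alpha> i) \<le> packing_const \<alpha> * grid_vol \<alpha> i0"
      using max by (intro grid_packing \<alpha> fin) (auto simp: G_def)
    then have "ennreal (\<Sum>i\<in>G. grid_vol \<alpha> i) \<le> ennreal (packing_const \<alpha>) * ennreal (grid_vol \<alpha> i0)"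
      using \<alpha> packing_const_pos[OF \<alpha>] grid_vol_pos[OF \<alpha>]
      by (simp add: ennreal_mult[symmetric] less_imp_le ennreal_leI)
    also have "\<dots> \<le> ennreal (packing_const \<alpha>) * (2 * (\<integral>\<^sup>+z\<in>grid_box i0. h z \<partial>dV \<alpha>))"
      using less.prems i0 by (intro mult_left_mono) auto
    also have "\<dots> = ennreal (2 * packing_const \<alpha>) * (\<integral>\<^sup>+z\<in>grid_box i0. h z \<partial>dV \<alpha>)"
      using packing_const_pos[OF \<alpha>] by (simp add: ennreal_mult less_imp_le ac_simps)
    finally have G: "ennreal (\<Sum>i\<in>G. grid_vol \<alpha> i)
       \<le> ennreal (2 * packing_const \<alpha>) * (\<integral>\<^sup>+z\<in>grid_box i0. h z \<partial>dV \<alpha>)" .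
    have disj: "z \<notin> grid_box i0" if "i \<in> H" "z \<in> grid_box i" for z i
      using that
      by (auto simp: H_def G_def Qbox_def)
    have [measurable]: "(\<Union>i\<in>H. grid_box i) \<in> sets (dV \<alpha>)"
      using fin by (intro sets.finite_UN) (auto intro: grid_box_sets_dV simp del: sets_dV)
    have "(\<Sum>i\<in>F. grid_vol \<alpha> i) = (\<Sum>i\<in>H. grid_vol \<alpha> i) + (\<Sum>i\<in>G. grid_vol \<alpha> i)"
      unfolding H_def by (rule sum.subset_diff) (use less.prems in \<open>auto simp: G_def\<close>)
    then have "ennreal (\<Sum>i\<in>F. grid_vol \<alpha> i) = ennreal (\<Sum>i\<in>H. grid_vol \<alpha> i) + ennreal (\<Sum>i\<in>G. grid_vol \<alpha> i)"
      using grid_vol_pos[OF \<alpha>] by (simp add: sum_nonneg less_imp_le)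
    also have "\<dots> \<le> ennreal (2 * packing_const \<alpha>) * ((\<integral>\<^sup>+z\<in>(\<Union>i\<in>H. grid_box i). h z \<partial>dV \<alpha>)
        + (\<integral>\<^sup>+z\<in>grid_box i0. h z \<partial>dV \<alpha>))"
      using IH G by (simp add: distrib_left add_mono)
    also have "(\<integral>\<^sup>+z\<in>(\<Union>i\<in>H. grid_box i). h z \<partial>dV \<alpha>) + (\<integral>\<^sup>+z\<in>grid_box i0. h z \<partial>dV \<alpha>)
        = (\<integral>\<^sup>+z\<in>(\<Union>i\<in>H. grid_box i) \<union> grid_box i0. h z \<partial>dV \<alpha>)"
      using disj by (subst nn_integral_add[symmetric]) (auto intro!: nn_integral_cong split: split_indicator dest: disj)
    also have "\<dots> \<le> (\<integral>\<^sup>+z\<in>(\<Union>i\<in>F. grid_box i). h z \<partial>dV \<alpha>)"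
      using i0 by (intro nn_integral_mono) (auto simp: H_def indicator_def)
    finally show ?thesis by (auto simp: mult_left_mono)
  qed
qed

section \<open>Powers of extended nonnegative reals\<close>

lemma enn_powr_ennreal: "0 \<le> x \<Longrightarrow> enn_powr (ennreal x) r = ennreal (x powr r)"
  by (simp add: enn_powr_def)

lemma enn_powr_top [simp]: "enn_powr top r = top"
  by (simp add: enn_powr_def)

lemma enn_powr_0 [simp]: "enn_powr 0 r = 0"
  by (simp add: enn_powr_def)

lemma enn_powr_1 [simp]: "enn_powr x 1 = x"
  by (cases x) (auto simp: enn_powr_ennreal)

lemma enn_powr_mono:
  assumes "x \<le> y" "0 \<le> r"
  shows "enn_powr x r \<le> enn_powr y r"
  using assms
  by (cases x; cases y) (auto simp: enn_powr_ennreal top_unique intro!: ennreal_leI powr_mono2)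

text \<open>The product 0 * top causes no exception: it is 0, and \<open>0 powr r = 0\<close> for
  every \<open>r\<close>. A positive base has a positive power, so its product with top stays top on
  both sides.\<close>

lemma enn_powr_mult: "enn_powr (x * y) r = enn_powr x r * enn_powr y r"
proof (cases x; cases y)
  fix a b :: real assume "0 \<le> a" "x = ennreal a" "0 \<le> b" "y = ennreal b"
  then show ?thesis by (simp add: enn_powr_ennreal powr_mult flip: ennreal_mult)
qed (auto simp: enn_powr_ennreal ennreal_mult_top ennreal_top_mult)

lemma enn_powr_powr: "enn_powr (enn_powr x a) b = enn_powr x (a * b)"
  by (cases x) (auto simp: enn_powr_ennreal powr_powr)

lemma enn_powr_add: "x \<noteq> top \<Longrightarrow> enn_powr x (a + b) = enn_powr x a * enn_powr x b"
  by (cases x) (auto simp: enn_powr_ennreal powr_add ennreal_mult)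

section \<open>Sums over countable index sets and dyadic layers\<close>

lemma nn_integral_count_space_le:
  fixes f :: "'a :: countable \<Rightarrow> ennreal"
  assumes inf: "infinite (UNIV :: 'a set)" and le: "\<And>F. finite F \<Longrightarrow> sum f F \<le> B"
  shows "(\<integral>\<^sup>+x. f x \<partial>count_space UNIV) \<le> B"
proof -
  let ?g = "from_nat_into (UNIV :: 'a set)"
  have g: "bij_betw ?g UNIV UNIV" using inf by (intro bij_betw_from_nat_into) auto
  have "(\<integral>\<^sup>+x. f x \<partial>count_space UNIV) = (\<Sum>n. f (?g n))"
    unfolding nn_integral_bij_count_space[OF g, symmetric] nn_integral_count_space_nat ..
  also have "\<dots> \<le> B"
  \<comment> \<open>Partial sums along the enumeration are sums over finite sets, to which the
    uniform bound applies.\<close>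
  proof (rule suminf_le_const)
    fix n
    have "(\<Sum>i<n. f (?g i)) = sum f (?g ` {..<n})"
      using g by (subst sum.reindex) (auto simp: bij_betw_def inj_on_def)
    then show "(\<Sum>i<n. f (?g i)) \<le> B" using le[of "?g ` {..<n}"] by simp
  qed simp
  finally show ?thesis .
qed

text \<open>The inclusion of l^1 in l^s: each term is at most the total S, so f^s is at most S^(s-1)
  f. It is applied with s = q/p, which is at least 1 since p \<le> q.\<close>

lemma nn_integral_count_space_powr_le:
  fixes f :: "'a :: countable \<Rightarrow> ennreal"
  assumes s: "1 \<le> s"
  shows "(\<integral>\<^sup>+x. enn_powr (f x) s \<partial>count_space UNIV) \<le> enn_powr (\<integral>\<^sup>+x. f x \<partial>count_space UNIV) s"
proof (cases "(\<integral>\<^sup>+x. f x \<partial>count_space UNIV) = top")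
  case False
  define S where "S = (\<integral>\<^sup>+x. f x \<partial>count_space UNIV)"
  have fS: "f x \<le> S" for x unfolding S_def by (rule nn_integral_ge_point) simp
  have "(\<integral>\<^sup>+x. enn_powr (f x) s \<partial>count_space UNIV) \<le> (\<integral>\<^sup>+x. enn_powr S (s - 1) * f x \<partial>count_space UNIV)"
  proof (rule nn_integral_mono)
    fix x
    have "f x \<noteq> top" using fS[of x] False by (auto simp: S_def top_unique)
    then have "enn_powr (f x) s = enn_powr (f x) (s - 1) * f x"
      using enn_powr_add[of "f x" "s - 1" 1] by simp
    also have "\<dots> \<le> enn_powr S (s - 1) * f x"
      using s fS by (intro mult_right_mono enn_powr_mono) auto
    finally show "enn_powr (f x) s \<le> enn_powr S (s - 1) * f x" .
  qed
  also have "\<dots> = enn_powr S (s - 1) * S" by (simp add: nn_integral_cmult S_def)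
  also have "\<dots> = enn_powr S s"
    using enn_powr_add[of S "s - 1" 1] False by (simp add: S_def)
  finally show ?thesis by (simp add: S_def)
qed simp

lemma dyadic_bracket:
  assumes "0 < (x::real)"
  obtains l :: int where "2 powr l < x" "x \<le> 2 powr (l + 1)"
proof -
  \<comment> \<open>Ceiling minus one instead of the floor: the lower inequality must be strict, as
    it is in the level sets \<open>2 powr l < N\<close>.\<close>
  define l where "l = \<lceil>log 2 x\<rceil> - 1"
  have "of_int l < log 2 x" "log 2 x \<le> of_int l + 1" unfolding l_def by linarith+
  then show thesis using assms that[of l]
    by (simp add: powr_less_iff le_powr_iff)
qed

text \<open>For finite positive \<open>N\<close> the single term with \<open>N\<close> between 2^l
  and 2^(l+1) already suffices, thanks to the exponent l + 1 in the weight. For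
  \<open>N = top\<close> every level is active and the weights are unbounded.\<close>

lemma enn_powr_le_dyadic_sum:
  assumes p: "p > 0"
  shows "enn_powr N p \<le> (\<integral>\<^sup>+l. ennreal (2 powr ((of_int l + 1) * p)) * indicator {l. ennreal (2 powr of_int l) < N} l
            \<partial>count_space (UNIV :: int set))" (is "_ \<le> nn_integral _ ?f")
proof (cases N)
  case (real x)
  show ?thesis
  proof (cases "x = 0")
    case False
    then obtain l :: int where l: "2 powr l < x" "x \<le> 2 powr (l + 1)"
      using dyadic_bracket[of x] real by auto
    have "x powr p \<le> (2 powr (l + 1)) powr p" using l p real by (intro powr_mono2) auto
    then have "enn_powr N p \<le> ?f l"
      using real l by (auto simp: enn_powr_ennreal powr_powr ennreal_less_iff intro!: ennreal_leI)
    also have "\<dots> \<le> nn_integral (count_space UNIV) ?f" by (rule nn_integral_ge_point) simp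
    finally show ?thesis .
  qed (use real in simp)
next
  case top
  have "nn_integral (count_space UNIV) ?f = top"
  proof (rule ccontr)
    assume "nn_integral (count_space UNIV) ?f \<noteq> top"
    then obtain B where B: "nn_integral (count_space UNIV) ?f = ennreal B" "B \<ge> 0"
      by (cases "nn_integral (count_space UNIV) ?f") auto
    \<comment> \<open>Chosen so that \<open>y powr p = B + 1\<close>, which forces one term of the
      sum above its supposed value \<open>B\<close>.\<close>
    define y where "y = (B + 1) powr (1 / p)"
    obtain l :: int where l: "2 powr l < y" "y \<le> 2 powr (l + 1)"
      using dyadic_bracket[of y] B by (auto simp: y_def)
    have "B + 1 = y powr p" using p B by (simp add: y_def powr_powr)
    also have "\<dots> \<le> (2 powr (l + 1)) powr p" using l p B by (intro powr_mono2) (auto simp: y_def)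
    finally have "ennreal (B + 1) \<le> ?f l" using top by (simp add: powr_powr ennreal_leI)
    also have "\<dots> \<le> nn_integral (count_space UNIV) ?f" by (rule nn_integral_ge_point) simp
    finally show False using B by simp
  qed
  then show ?thesis by simp
qed

section \<open>Young functions of class B_p\<close>

text \<open>The hypotheses say nothing about \<Phi> on negative numbers. Composition with
  \<open>max 0\<close> gives a function that is continuous, hence Borel, on the whole line and
  agrees with \<Phi> where it is used.\<close>

lemma young_function_cont_max:
  assumes "young_function \<Phi>"
  shows "continuous_on UNIV (\<lambda>s. \<Phi> (max 0 s))"
proof -
  have "continuous_on {0..} \<Phi>" using assms by (simp add: young_function_def)
  then show ?thesis
    by (rule continuous_on_compose2) (auto intro!: continuous_intros)
qed

lemma young_function_measurable [measurable (raw)]: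
  assumes "young_function \<Phi>" and [measurable]: "g \<in> borel_measurable M" and "\<And>z. z \<in> space M \<Longrightarrow> 0 \<le> g z"
  shows "(\<lambda>z. \<Phi> (g z)) \<in> borel_measurable M"
proof -
  have [measurable]: "(\<lambda>s. \<Phi> (max 0 s)) \<in> borel_measurable borel"
    by (intro borel_measurable_continuous_onI young_function_cont_max assms)
  have "(\<lambda>z. \<Phi> (max 0 (g z))) \<in> borel_measurable M" by measurable
  then show ?thesis using assms(3) by (subst measurable_cong[where g = "\<lambda>z. \<Phi> (max 0 (g z))"]) auto
qed

lemma young_function_nonneg: "young_function \<Phi> \<Longrightarrow> 0 \<le> t \<Longrightarrow> 0 \<le> \<Phi> t"
  by (simp add: young_function_def)

lemma young_function_mono: "young_function \<Phi> \<Longrightarrow> 0 \<le> s \<Longrightarrow> s \<le> t \<Longrightarrow> \<Phi> s \<le> \<Phi> t"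
  by (auto simp: young_function_def mono_on_def)

text \<open>Convexity and \<Phi> 0 = 0 give \<Phi> \<epsilon> \<le> \<epsilon> * \<Phi> 1 for
  \<epsilon> up to 1. The value 1/2 is the share of a mean that can later be absorbed.\<close>

lemma young_function_small:
  assumes "young_function \<Phi>"
  obtains \<epsilon> where "\<epsilon> > 0" "\<Phi> \<epsilon> \<le> 1 / 2"
proof -
  define \<epsilon> where "\<epsilon> = 1 / (2 * (\<Phi> 1 + 1))"
  have P: "\<Phi> 1 \<ge> 0" using assms by (simp add: young_function_nonneg)
  then have e: "0 < \<epsilon>" "\<epsilon> \<le> 1" by (auto simp: \<epsilon>_def field_simps)
  have "convex_on {0..} \<Phi>" "\<Phi> 0 = 0" using assms by (auto simp: young_function_def)
  then have "\<Phi> ((1 - \<epsilon>) *\<^sub>R 0 + \<epsilon> *\<^sub>R 1) \<le> (1 - \<epsilon>) * \<Phi> 0 + \<epsilon> * \<Phi> 1"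
    using e by (intro convex_onD) auto
  then have "\<Phi> \<epsilon> \<le> \<epsilon> * \<Phi> 1" using \<open>\<Phi> 0 = 0\<close> by simp
  also have "\<dots> \<le> 1 / 2" using P by (simp add: \<epsilon>_def field_simps)
  finally show thesis using that e by blast
qed

text \<open>The class provides some cut-off \<open>c\<close>, whereas \<epsilon> is dictated by the
  smallness of \<Phi>. Between \<epsilon> and \<open>c\<close>, if anything lies there, monotonicity
  bounds the integrand by the constant \<open>K\<close>.\<close>

lemma Bp_tail_finite:
  assumes Bp: "Bp_class p \<Phi>" and p: "p > 0" and \<epsilon>: "\<epsilon> > 0"
  shows "(\<integral>\<^sup>+t\<in>{\<epsilon>..}. ennreal ((\<Phi> t / t powr p) / t) \<partial>lborel) < \<infinity>"
proof -
  have Y: "young_function \<Phi>" using Bp by (simp add: Bp_class_def)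
  obtain c where c: "c > 0" "(\<integral>\<^sup>+t\<in>{c..}. ennreal ((\<Phi> t / t powr p) / t) \<partial>lborel) < \<infinity>"
    using Bp by (auto simp: Bp_class_def)
  define K where "K = \<Phi> c / \<epsilon> powr p / \<epsilon>"
  have [measurable]: "(\<lambda>s. \<Phi> (max 0 s)) \<in> borel_measurable borel"
    by (intro borel_measurable_continuous_onI young_function_cont_max Y)
  define G where "G t = ennreal ((\<Phi> (max 0 t) / t powr p) / t)" for t
  have [measurable]: "G \<in> borel_measurable borel" unfolding G_def by measurable
  have "(\<integral>\<^sup>+t\<in>{\<epsilon>..}. ennreal ((\<Phi> t / t powr p) / t) \<partial>lborel)
      \<le> (\<integral>\<^sup>+t. ennreal K * indicator {\<epsilon>..c} t + G t * indicator {c..} t \<partial>lborel)"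
  proof (rule nn_integral_mono)
    fix t
    have "ennreal ((\<Phi> t / t powr p) / t) \<le> ennreal K" if "\<epsilon> \<le> t" "t \<le> c"
      unfolding K_def using that \<epsilon> p
      by (intro ennreal_leI divide_mono frac_le young_function_mono[OF Y] powr_mono2 young_function_nonneg[OF Y]
          divide_nonneg_nonneg mult_pos_pos) auto
    moreover have "ennreal ((\<Phi> t / t powr p) / t) = G t" if "c \<le> t"
      using that c by (simp add: G_def)
    ultimately show "ennreal ((\<Phi> t / t powr p) / t) * indicator {\<epsilon>..} t
         \<le> ennreal K * indicator {\<epsilon>..c} t + G t * indicator {c..} t"
      by (auto simp: indicator_def)
  qed
  also have "\<dots> = ennreal K * emeasure lborel {\<epsilon>..c} + (\<integral>\<^sup>+t. G t * indicator {c..} t \<partial>lborel)"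
    by (subst nn_integral_add) (auto simp: nn_integral_cmult_indicator)
  also have "(\<integral>\<^sup>+t. G t * indicator {c..} t \<partial>lborel) = (\<integral>\<^sup>+t\<in>{c..}. ennreal ((\<Phi> t / t powr p) / t) \<partial>lborel)"
    using c by (intro nn_integral_cong) (auto simp: G_def indicator_def)
  also have "ennreal K * emeasure lborel {\<epsilon>..c} + \<dots> < \<infinity>"
    using c by (auto simp: ennreal_mult_less_top emeasure_lborel_Icc_eq)
  finally show ?thesis .
qed

text \<open>With u = t/2^l the sum is a Riemann sum for t^p times the integral of \<Phi> s / s^(p+1)
  over s \<ge> \<epsilon>: on {u..<2u} one has \<Phi> s \<ge> \<Phi> u and s^(p+1) \<le> (2u)^(p+1),
  and these blocks are disjoint for different l.\<close>

lemma Bp_dyadic_sum: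
  assumes Bp: "Bp_class p \<Phi>" and p: "p > 0" and \<epsilon>: "\<epsilon> > 0"
  obtains C where "C > 0" "\<And>t. t \<ge> 0 \<Longrightarrow>
     (\<integral>\<^sup>+l. ennreal (2 powr ((of_int l + 1) * p) * \<Phi> (t / 2 powr of_int l)) * indicator {l. \<epsilon> * 2 powr of_int l < t} l
        \<partial>count_space (UNIV :: int set)) \<le> ennreal (C * t powr p)"
proof -
  have Y: "young_function \<Phi>" using Bp by (simp add: Bp_class_def)
  define I where "I = (\<integral>\<^sup>+t\<in>{\<epsilon>..}. ennreal ((\<Phi> t / t powr p) / t) \<partial>lborel)"
  have I: "I < \<infinity>" unfolding I_def by (rule Bp_tail_finite assms)+
  \<comment> \<open>A factor 2^p comes from the weight 2^((l+1)p) in place of 2^(lp), and 2^(p+1)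
    from replacing s by 2u in the denominator.\<close>
  define c where "c = 2 powr (2 * p + 1)"
  \<comment> \<open>The added 1 makes \<open>C\<close> positive without a lower bound for
    \<open>I\<close>.\<close>
  define C where "C = c * (enn2real I + 1)"
  have [measurable]: "(\<lambda>s. \<Phi> (max 0 s)) \<in> borel_measurable borel"
    by (intro borel_measurable_continuous_onI young_function_cont_max Y)
  define G where "G t = ennreal ((\<Phi> (max 0 t) / t powr p) / t)" for t
  have [measurable]: "G \<in> borel_measurable borel" unfolding G_def by measurable
  \<comment> \<open>As a measure, the integral over disjoint blocks is summed by countable
    additivity.\<close>
  define M where "M = density lborel G"
  have "(\<integral>\<^sup>+l. ennreal (2 powr ((of_int l + 1) * p) * \<Phi> (t / 2 powr of_int l)) * indicator {l. \<epsilon> * 2 powr of_int l < t} l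
        \<partial>count_space (UNIV :: int set)) \<le> ennreal (C * t powr p)" if "t \<ge> 0" for t
  proof (cases "t = 0")
    case True
    have "indicator {l::int. \<epsilon> * 2 powr of_int l < t} l = (0::ennreal)" for l
      using \<epsilon> True by (auto simp: indicator_def mult_less_0_iff not_less)
    then show ?thesis by simp
  next
    case False
    then have t: "t > 0" using that by simp
    define u where "u l = t / 2 powr of_int l" for l :: int
    \<comment> \<open>The block is empty for the excluded \<open>l\<close>, so the union of all
      blocks stays inside {\<epsilon>..}.\<close>
    define A where "A l = (if \<epsilon> * 2 powr of_int l < t then {u l ..< 2 * u l} else {})" for l :: int
    have u: "u l > 0" for l using t by (simp add: u_def)
    have term_le: "ennreal (2 powr ((of_int l + 1) * p) * \<Phi> (u l)) * indicator {l. \<epsilon> * 2 powr of_int l < t} l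
        \<le> ennreal (c * t powr p) * emeasure M (A l)" for l
    proof (cases "\<epsilon> * 2 powr of_int l < t")
      case True
      have "2 powr ((of_int l + 1) * p) * \<Phi> (u l) = c * t powr p * (\<Phi> (u l) / (2 * u l) powr p / (2 * u l) * u l)"
      proof -
        have "2 powr ((of_int l + 1) * p) = (2 * t / u l) powr p"
          using t unfolding powr_powr[symmetric] by (simp add: u_def powr_add mult.commute)
        then have e: "2 powr ((of_int l + 1) * p) = 2 powr p * t powr p / u l powr p"
          using u[of l] t by (simp add: powr_mult powr_divide)
        have e2: "(2 * u l) powr p = 2 powr p * u l powr p"
          using u[of l] by (simp add: powr_mult)
        have "c = 2 powr (p + p + 1)" by (simp add: c_def)
        then have e3: "c = 2 * 2 powr p * 2 powr p" by (simp only: powr_add) simp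
        have "u l powr p > 0" "(2::real) powr p > 0" using u[of l] by auto
        then show ?thesis unfolding e e2 e3 using u[of l] by (simp add: field_simps)
      qed
      then have "ennreal (2 powr ((of_int l + 1) * p) * \<Phi> (u l))
         = ennreal (c * t powr p) * (ennreal (\<Phi> (u l) / (2 * u l) powr p / (2 * u l)) * emeasure lborel {u l ..< 2 * u l})"
        using u[of l] Y by (simp add: ennreal_mult[symmetric] c_def young_function_nonneg)
      also have "\<dots> = ennreal (c * t powr p) *
          (\<integral>\<^sup>+s. ennreal (\<Phi> (u l) / (2 * u l) powr p / (2 * u l)) * indicator {u l ..< 2 * u l} s \<partial>lborel)"
        by (subst nn_integral_cmult_indicator) auto
      also have "\<dots> \<le> ennreal (c * t powr p) * (\<integral>\<^sup>+s. G s * indicator {u l ..< 2 * u l} s \<partial>lborel)"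
      proof (intro mult_left_mono nn_integral_mono)
        fix s
        have "\<Phi> (u l) / (2 * u l) powr p / (2 * u l) \<le> \<Phi> s / s powr p / s" if "u l \<le> s" "s < 2 * u l"
          using that u[of l] p
          by (intro frac_le young_function_mono[OF Y] powr_mono2 young_function_nonneg[OF Y]
              divide_nonneg_nonneg) auto
        then show "ennreal (\<Phi> (u l) / (2 * u l) powr p / (2 * u l)) * indicator {u l ..< 2 * u l} s
           \<le> G s * indicator {u l ..< 2 * u l} s"
          using u[of l] by (auto simp: indicator_def G_def intro!: ennreal_leI)
      qed auto
      also have "(\<integral>\<^sup>+s. G s * indicator {u l ..< 2 * u l} s \<partial>lborel) = emeasure M (A l)"
        using True by (simp add: M_def A_def emeasure_density)
      finally show ?thesis using True by simp
    qed simp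
    have disj: "disjoint_family_on A UNIV"
    proof -
      have "A l \<inter> A m = {}" if "l < m" for l m
      proof -
        have "2 powr (of_int l + 1) \<le> 2 powr real_of_int m" using that by (intro powr_mono) auto
        then have "2 * u m \<le> u l" using t by (simp add: u_def field_simps powr_add)
        then show ?thesis by (auto simp: A_def)
      qed
      then show ?thesis unfolding disjoint_family_on_def by (metis Int_commute linorder_neqE)
    qed
    have "(\<integral>\<^sup>+l. ennreal (2 powr ((of_int l + 1) * p) * \<Phi> (u l)) * indicator {l. \<epsilon> * 2 powr of_int l < t} l
        \<partial>count_space UNIV) \<le> (\<integral>\<^sup>+l. ennreal (c * t powr p) * emeasure M (A l) \<partial>count_space UNIV)"
      by (intro nn_integral_mono term_le)
    also have "\<dots> = ennreal (c * t powr p) * emeasure M (\<Union>l. A l)"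
      by (subst emeasure_UN_countable[OF _ _ disj]) (auto simp: M_def A_def nn_integral_cmult)
    also have "emeasure M (\<Union>l. A l) \<le> emeasure M {\<epsilon>..}"
    proof (rule emeasure_mono)
      show "(\<Union>l. A l) \<subseteq> {\<epsilon>..}"
      proof (intro UN_least subsetI)
        fix l s assume "s \<in> A l"
        then have "\<epsilon> * 2 powr of_int l < t" "u l \<le> s" by (auto simp: A_def split: if_splits)
        then have "\<epsilon> < u l" "u l \<le> s" by (auto simp: u_def field_simps)
        then show "s \<in> {\<epsilon>..}" by simp
      qed
    qed (simp add: M_def)
    also have "emeasure M {\<epsilon>..} = I"
      using \<epsilon> by (auto simp: M_def emeasure_density I_def G_def indicator_def intro!: nn_integral_cong)
    also have "ennreal (c * t powr p) * I \<le> ennreal (C * t powr p)"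
    proof -
      obtain x where x: "I = ennreal x" "x \<ge> 0" using I by (cases I) auto
      have "c * t powr p * x \<le> c * (x + 1) * t powr p" by (simp add: c_def algebra_simps)
      then show ?thesis unfolding C_def x(1) using x(2)
        by (subst ennreal_mult[symmetric]) (auto simp: c_def intro!: ennreal_leI)
    qed
    finally show ?thesis by (auto simp: mult_left_mono u_def)
  qed
  moreover have "C > 0" by (auto simp: C_def c_def intro!: mult_pos_pos add_nonneg_pos)
  ultimately show thesis using that by blast
qed

lemma grid_box_subset_UHP: "grid_box i \<subseteq> UHP"
  by (auto simp: Qbox_def UHP_def)

section \<open>An embedding for Luxemburg norms\<close>

lemma UHP_sets_lebesgue [measurable]: "UHP \<in> sets lebesgue"
proof -
  have "UHP \<in> sets borel" unfolding UHP_def by measurable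
  then show ?thesis by auto
qed

lemma borel_measurable_dV: "borel_measurable (dV \<alpha>) = borel_measurable lebesgue"
  by (intro measurable_cong_sets) auto

lemma young_ext_ennreal_divide:
  "0 \<le> x \<Longrightarrow> 0 < r \<Longrightarrow> young_ext F (ennreal x / ennreal r) = F (x / r)"
  by (simp add: young_ext_def divide_ennreal)

text \<open>A positive number strictly below the infimum is not admissible, so the mean of \<Phi> (g
  / r) over the box exceeds 1.\<close>

lemma less_luxemburg_grid_interval:
  assumes \<alpha>: "\<alpha> > -1" and g: "\<And>z. 0 \<le> g z" and r: "0 < r"
    and less: "ennreal r < luxemburg (young_ext (\<lambda>s. ennreal (\<Phi> s))) \<alpha> (grid_interval i) (\<lambda>z. ennreal (g z))"
  shows "ennreal (grid_vol \<alpha> i) < (\<integral>\<^sup>+z\<in>grid_box i. ennreal (\<Phi> (g z / r)) \<partial>dV \<alpha>)"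
proof (rule ccontr)
  assume "\<not> ?thesis"
  then have "ennreal (1 / grid_vol \<alpha> i) * (\<integral>\<^sup>+z\<in>grid_box i. ennreal (\<Phi> (g z / r)) \<partial>dV \<alpha>)
     \<le> ennreal (1 / grid_vol \<alpha> i) * ennreal (grid_vol \<alpha> i)"
    by (intro mult_left_mono) auto
  also have "\<dots> = 1" using grid_vol_pos[OF \<alpha>, of i] by (simp add: ennreal_mult[symmetric])
  finally have "luxemburg (young_ext (\<lambda>s. ennreal (\<Phi> s))) \<alpha> (grid_interval i) (\<lambda>z. ennreal (g z)) \<le> ennreal r"
    unfolding luxemburg_def using r \<alpha> g
    by (intro Inf_lower) (auto simp: Qvol_grid_interval young_ext_ennreal_divide)
  then show False using less by simp
qed

text \<open>A Carleson embedding in place of an L^p bound for the maximal operator of Luxemburg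
  averages. Once the sums and integrals are exchanged, what remains at each point \<open>z\<close>
  is the sum of \<open>Bp_dyadic_sum\<close> with \<open>t = g z\<close>.\<close>

lemma luxemburg_embedding:
  assumes \<alpha>: "\<alpha> > -1" and p: "p > 0" and Bp: "Bp_class p \<Phi>"
  obtains C where "C > 0"
    "\<And>g. g \<in> borel_measurable lebesgue \<Longrightarrow> (\<And>z. 0 \<le> g z) \<Longrightarrow>
      (\<integral>\<^sup>+i. ennreal (grid_vol \<alpha> i) *
          enn_powr (luxemburg (young_ext (\<lambda>s. ennreal (\<Phi> s))) \<alpha> (grid_interval i) (\<lambda>z. ennreal (g z))) p
        \<partial>count_space UNIV) \<le> ennreal C * (\<integral>\<^sup>+z\<in>UHP. ennreal (g z powr p) \<partial>dV \<alpha>)"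
proof -
  have Y: "young_function \<Phi>" using Bp by (simp add: Bp_class_def)
  obtain \<epsilon> where \<epsilon>: "\<epsilon> > 0" "\<Phi> \<epsilon> \<le> 1 / 2" using young_function_small[OF Y] .
  obtain C1 where C1: "C1 > 0" "\<And>t. t \<ge> 0 \<Longrightarrow>
     (\<integral>\<^sup>+l. ennreal (2 powr ((of_int l + 1) * p) * \<Phi> (t / 2 powr of_int l)) * indicator {l. \<epsilon> * 2 powr of_int l < t} l
        \<partial>count_space (UNIV :: int set)) \<le> ennreal (C1 * t powr p)"
    using Bp_dyadic_sum[OF Bp p \<epsilon>(1)] by blast
  define C0 where "C0 = 2 * packing_const \<alpha>"
  have C0: "C0 > 0" using packing_const_pos[OF \<alpha>] by (simp add: C0_def)
  have main: "(\<integral>\<^sup>+i. ennreal (grid_vol \<alpha> i) *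
          enn_powr (luxemburg (young_ext (\<lambda>s. ennreal (\<Phi> s))) \<alpha> (grid_interval i) (\<lambda>z. ennreal (g z))) p
        \<partial>count_space UNIV) \<le> ennreal (C0 * C1) * (\<integral>\<^sup>+z\<in>UHP. ennreal (g z powr p) \<partial>dV \<alpha>)"
    if g: "g \<in> borel_measurable lebesgue" and g0: "\<And>z. 0 \<le> g z" for g :: "complex \<Rightarrow> real"
  proof -
    have [measurable]: "g \<in> borel_measurable (dV \<alpha>)" using g by (simp add: borel_measurable_dV)
    define N where "N i = luxemburg (young_ext (\<lambda>s. ennreal (\<Phi> s))) \<alpha> (grid_interval i) (\<lambda>z. ennreal (g z))" for i
    define S where "S l = {i. ennreal (2 powr of_int l) < N i}" for l :: int
    \<comment> \<open>The truncation keeps, at each \<open>z\<close>, only the levels with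
      \<open>2 powr l\<close> below \<open>g z / \<epsilon>\<close>, where the argument of \<Phi>
      stays above \<epsilon> and the B_p tail applies.\<close>
    define h where "h l z = ennreal (\<Phi> (g z / 2 powr of_int l)) * indicator {l. \<epsilon> * 2 powr of_int l < g z} l" for l :: int and z
    have [measurable]: "(\<lambda>z. \<Phi> (g z / 2 powr of_int l)) \<in> borel_measurable (dV \<alpha>)" for l :: int
      using g0 by (intro young_function_measurable[OF Y]) auto
    have h_meas [measurable]: "h l \<in> borel_measurable (dV \<alpha>)" for l
    proof -
      have "h l = (\<lambda>z. ennreal (\<Phi> (g z / 2 powr of_int l)) * indicator {z \<in> space (dV \<alpha>). \<epsilon> * 2 powr of_int l < g z} z)"
        by (auto simp: h_def indicator_def)
      also have "\<dots> \<in> borel_measurable (dV \<alpha>)" by measurable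
      finally show ?thesis .
    qed
    have level: "(\<integral>\<^sup>+i. ennreal (grid_vol \<alpha> i) * indicator (S l) i \<partial>count_space UNIV)
        \<le> ennreal C0 * (\<integral>\<^sup>+z\<in>UHP. h l z \<partial>dV \<alpha>)" for l
    proof (rule nn_integral_count_space_le)
      fix F :: "(int \<times> int) set" assume F: "finite F"
      have cut: "ennreal (grid_vol \<alpha> i) \<le> 2 * (\<integral>\<^sup>+z\<in>grid_box i. h l z \<partial>dV \<alpha>)" if "i \<in> F \<inter> S l" for i
      proof -
        have "ennreal (grid_vol \<alpha> i) \<le> (\<integral>\<^sup>+z\<in>grid_box i. ennreal (\<Phi> (g z / 2 powr of_int l)) \<partial>dV \<alpha>)"
          using that by (intro less_imp_le less_luxemburg_grid_interval \<alpha> g0) (auto simp: S_def N_def)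
        also have "\<dots> \<le> (\<integral>\<^sup>+z. h l z * indicator (grid_box i) z + ennreal (1 / 2) * indicator (grid_box i) z \<partial>dV \<alpha>)"
        proof (rule nn_integral_mono)
          fix z
          have "ennreal (\<Phi> (g z / 2 powr of_int l)) \<le> ennreal (1 / 2)" if "\<not> \<epsilon> * 2 powr of_int l < g z"
          proof -
            have "g z / 2 powr of_int l \<le> \<epsilon>" using that by (simp add: field_simps)
            then have "\<Phi> (g z / 2 powr of_int l) \<le> \<Phi> \<epsilon>" using g0 by (intro young_function_mono[OF Y]) auto
            then show ?thesis using \<epsilon> by (intro ennreal_leI) simp
          qed
          then show "ennreal (\<Phi> (g z / 2 powr of_int l)) * indicator (grid_box i) z
              \<le> h l z * indicator (grid_box i) z + ennreal (1 / 2) * indicator (grid_box i) z"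
            unfolding h_def indicator_def by auto
        qed
        also have "\<dots> = (\<integral>\<^sup>+z\<in>grid_box i. h l z \<partial>dV \<alpha>) + ennreal (1 / 2) * ennreal (grid_vol \<alpha> i)"
          using emeasure_grid_box[OF \<alpha>, of i] grid_box_sets_dV[of i \<alpha>]
          by (subst nn_integral_add) (auto simp: nn_integral_cmult_indicator simp del: sets_dV)
        also have "ennreal (1 / 2) * ennreal (grid_vol \<alpha> i) = ennreal (grid_vol \<alpha> i / 2)"
          using grid_vol_pos[OF \<alpha>, of i] by (subst ennreal_mult[symmetric]) auto
        finally have le: "ennreal (grid_vol \<alpha> i) \<le> (\<integral>\<^sup>+z\<in>grid_box i. h l z \<partial>dV \<alpha>) + ennreal (grid_vol \<alpha> i / 2)" .
        \<comment> \<open>Half of the volume is absorbed on the left by subtraction, which is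
          legitimate only when the integral is finite; otherwise the bound is trivial.\<close>
        show ?thesis
        proof (cases "\<integral>\<^sup>+z\<in>grid_box i. h l z \<partial>dV \<alpha>")
          case (real x)
          then have "grid_vol \<alpha> i \<le> x + grid_vol \<alpha> i / 2"
            using le grid_vol_pos[OF \<alpha>, of i] by (simp add: ennreal_plus[symmetric] del: ennreal_plus)
          then have "ennreal (grid_vol \<alpha> i) \<le> ennreal (2 * x)" by (intro ennreal_leI) simp
          then show ?thesis using real by (simp add: ennreal_mult)
        qed (simp add: ennreal_mult_top)
      qed
      have "(\<Sum>i\<in>F. ennreal (grid_vol \<alpha> i) * indicator (S l) i) = ennreal (\<Sum>i\<in>F \<inter> S l. grid_vol \<alpha> i)"
        using F grid_vol_pos[OF \<alpha>]
        by (subst sum_ennreal[symmetric]) (auto simp: sum.inter_restrict less_imp_le indicator_def intro!: sum.cong)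
      also have "\<dots> \<le> ennreal C0 * (\<integral>\<^sup>+z\<in>(\<Union>i\<in>F \<inter> S l. grid_box i). h l z \<partial>dV \<alpha>)"
        unfolding C0_def using F cut by (intro grid_vitali[OF \<alpha>]) auto
      also have "\<dots> \<le> ennreal C0 * (\<integral>\<^sup>+z\<in>UHP. h l z \<partial>dV \<alpha>)"
        using grid_box_subset_UHP by (intro mult_left_mono nn_integral_mono) (auto simp: indicator_def)
      finally show "(\<Sum>i\<in>F. ennreal (grid_vol \<alpha> i) * indicator (S l) i) \<le> ennreal C0 * (\<integral>\<^sup>+z\<in>UHP. h l z \<partial>dV \<alpha>)" .
    qed (simp add: finite_prod)
    define w where "w l = ennreal (2 powr ((of_int l + 1) * p))" for l :: int
    have "(\<integral>\<^sup>+i. ennreal (grid_vol \<alpha> i) * enn_powr (N i) p \<partial>count_space UNIV)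
      \<le> (\<integral>\<^sup>+i. ennreal (grid_vol \<alpha> i) * (\<integral>\<^sup>+l. w l * indicator (S l) i \<partial>count_space UNIV) \<partial>count_space UNIV)"
      using enn_powr_le_dyadic_sum[OF p]
      by (intro nn_integral_mono mult_left_mono) (auto simp: w_def S_def indicator_def)
    also have "\<dots> = (\<integral>\<^sup>+i. \<integral>\<^sup>+l. w l * (ennreal (grid_vol \<alpha> i) * indicator (S l) i) \<partial>count_space UNIV \<partial>count_space UNIV)"
      by (subst nn_integral_cmult[symmetric]) (auto simp: ac_simps)
    also have "\<dots> = (\<integral>\<^sup>+l. \<integral>\<^sup>+i. w l * (ennreal (grid_vol \<alpha> i) * indicator (S l) i) \<partial>count_space UNIV \<partial>count_space UNIV)"
      by (rule nn_integral_count_space_nn_integral) auto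
    also have "\<dots> \<le> (\<integral>\<^sup>+l. w l * (ennreal C0 * (\<integral>\<^sup>+z\<in>UHP. h l z \<partial>dV \<alpha>)) \<partial>count_space UNIV)"
      using level by (subst nn_integral_cmult) (auto intro!: nn_integral_mono mult_left_mono)
    also have "\<dots> = (\<integral>\<^sup>+l. \<integral>\<^sup>+z. ennreal C0 * (w l * h l z * indicator UHP z) \<partial>dV \<alpha> \<partial>count_space UNIV)"
      by (subst nn_integral_cmult, simp)+ (auto simp: ac_simps nn_integral_cmult intro!: nn_integral_cong)
    \<comment> \<open>Tonelli between counting measure and \<open>dV \<alpha>\<close> turns the
      claim into a pointwise one in \<open>z\<close>.\<close>
    also have "\<dots> = (\<integral>\<^sup>+z. \<integral>\<^sup>+l. ennreal C0 * (w l * h l z * indicator UHP z) \<partial>count_space UNIV \<partial>dV \<alpha>)"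
      by (rule nn_integral_count_space_nn_integral[symmetric]) auto
    also have "\<dots> \<le> (\<integral>\<^sup>+z. ennreal (C0 * C1) * (ennreal (g z powr p) * indicator UHP z) \<partial>dV \<alpha>)"
    proof (rule nn_integral_mono)
      fix z
      have "(\<integral>\<^sup>+l. ennreal C0 * (w l * h l z * indicator UHP z) \<partial>count_space UNIV)
          = ennreal C0 * ((\<integral>\<^sup>+l. w l * h l z \<partial>count_space UNIV) * indicator UHP z)"
        by (simp add: nn_integral_cmult nn_integral_multc)
      also have "(\<integral>\<^sup>+l. w l * h l z \<partial>count_space UNIV) = (\<integral>\<^sup>+l. ennreal (2 powr ((of_int l + 1) * p) * \<Phi> (g z / 2 powr of_int l)) *
          indicator {l. \<epsilon> * 2 powr of_int l < g z} l \<partial>count_space (UNIV :: int set))"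
        using g0 by (intro nn_integral_cong) (simp add: w_def h_def ennreal_mult young_function_nonneg[OF Y] ac_simps)
      also have "\<dots> \<le> ennreal (C1 * g z powr p)" by (rule C1) (rule g0)
      also have "ennreal C0 * (ennreal (C1 * g z powr p) * indicator UHP z)
          = ennreal (C0 * C1) * (ennreal (g z powr p) * indicator UHP z)"
        using C0 C1 by (simp add: ennreal_mult less_imp_le ac_simps)
      finally show "(\<integral>\<^sup>+l. ennreal C0 * (w l * h l z * indicator UHP z) \<partial>count_space UNIV)
         \<le> ennreal (C0 * C1) * (ennreal (g z powr p) * indicator UHP z)"
        by (auto simp: mult_left_mono mult_right_mono)
    qed
    also have "\<dots> = ennreal (C0 * C1) * (\<integral>\<^sup>+z\<in>UHP. ennreal (g z powr p) \<partial>dV \<alpha>)"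
      by (subst nn_integral_cmult) auto
    finally show ?thesis unfolding N_def .
  qed
  show thesis using C0 C1(1) by (intro that[of "C0 * C1"] main) auto
qed

section \<open>Hoelder's inequality in Orlicz norm\<close>

text \<open>A supremum of continuous functions is lower semicontinuous: its superlevel sets are
  unions of open sets, even though the family is uncountable.\<close>

lemma complementary_measurable [measurable]: "complementary \<Phi> \<in> borel_measurable borel"
proof (rule borel_measurableI_greater)
  fix y
  have "open {s. y < ennreal (t * s - \<Phi> t)}" for t
    by (intro open_Collect_less continuous_on_ennreal continuous_intros)
  moreover have "{s \<in> space borel. y < complementary \<Phi> s} = (\<Union>t\<in>{0..}. {s. y < ennreal (t * s - \<Phi> t)})"
    by (auto simp: complementary_def less_SUP_iff)
  ultimately show "{s \<in> space borel. y < complementary \<Phi> s} \<in> sets borel"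
    by (auto intro!: borel_open open_UN)
qed

lemma young_ext_measurable [measurable (raw)]:
  assumes [measurable]: "F \<in> borel_measurable borel" "x \<in> borel_measurable M"
  shows "(\<lambda>z. young_ext F (x z)) \<in> borel_measurable M"
  unfolding young_ext_def by measurable

lemma young_inequality:
  assumes "0 \<le> s" "0 \<le> t" "0 \<le> \<Phi> t"
  shows "ennreal (s * t) \<le> ennreal (\<Phi> t) + complementary \<Phi> s"
proof -
  \<comment> \<open>\<open>ennreal\<close> sends a negative difference to 0, so the maximum with 0
    is what the complementary function actually bounds.\<close>
  have "ennreal (s * t) \<le> ennreal (\<Phi> t + max 0 (t * s - \<Phi> t))"
    by (intro ennreal_leI) (simp add: algebra_simps)
  also have "\<dots> = ennreal (\<Phi> t) + ennreal (t * s - \<Phi> t)"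
    using assms by (subst ennreal_plus) (auto simp: max_def ennreal_neg)
  also have "ennreal (t * s - \<Phi> t) \<le> complementary \<Phi> s"
    unfolding complementary_def using assms by (intro SUP_upper) auto
  finally show ?thesis by (simp add: add_left_mono)
qed

text \<open>Passes from admissible \<open>r\<close> to their infimum by dividing by
  \<open>c\<close>. For \<open>c = 0\<close> division is impossible; there the finite norm
  guarantees some admissible \<open>r\<close>, which gives X = 0.\<close>

lemma le_mult_luxemburg:
  assumes fin: "luxemburg F \<alpha> I g \<noteq> top" "c \<noteq> top"
    and le: "\<And>r. 0 < r \<Longrightarrow> ennreal (1 / Qvol \<alpha> I) * (\<integral>\<^sup>+z\<in>Qbox I. F (g z / ennreal r) \<partial>dV \<alpha>) \<le> 1
      \<Longrightarrow> X \<le> c * ennreal r"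
  shows "X \<le> c * luxemburg F \<alpha> I g"
proof (cases "c = 0")
  case True
  have "{ennreal r | r. r > 0 \<and>
      ennreal (1 / Qvol \<alpha> I) * set_nn_integral (dV \<alpha>) (Qbox I) (\<lambda>z. F (g z / ennreal r)) \<le> 1} \<noteq> {}"
    using fin(1) unfolding luxemburg_def by (metis (no_types, lifting) Inf_empty)
  then obtain r where "0 < r" "ennreal (1 / Qvol \<alpha> I) * set_nn_integral (dV \<alpha>) (Qbox I) (\<lambda>z. F (g z / ennreal r)) \<le> 1"
    by blast
  then show ?thesis using le[of r] True by simp
next
  case False
  have "X / c \<le> luxemburg F \<alpha> I g"
    unfolding luxemburg_def
  proof (rule Inf_greatest, clarify)
    fix r :: real assume "0 < r" "ennreal (1 / Qvol \<alpha> I) * set_nn_integral (dV \<alpha>) (Qbox I) (\<lambda>z. F (g z / ennreal r)) \<le> 1"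
    then have "X \<le> c * ennreal r" by (rule le)
    then show "X / c \<le> ennreal r"
      using False fin by (subst divide_le_posI_ennreal) (auto simp: zero_less_iff_neq_zero)
  qed
  then have "c * (X / c) \<le> c * luxemburg F \<alpha> I g" by (rule mult_left_mono) simp
  then show ?thesis using False fin by (simp add: ennreal_times_divide ennreal_mult_divide_eq mult.commute)
qed

text \<open>For admissible \<kappa> and \<open>r\<close>, Young's inequality is applied to f
  \<omega> / \<kappa> and 1 / (\<omega> r), whose product is f / (\<kappa> r). The two resulting
  integrals are at most the volume each, hence the factor 2.\<close>

lemma orlicz_hoelder:
  assumes \<alpha>: "\<alpha> > -1" and Y: "young_function \<Phi>"
    and f: "f \<in> borel_measurable lebesgue" "\<And>z. 0 \<le> f z"
    and \<omega>: "\<omega> \<in> borel_measurable lebesgue" "\<And>z. 0 \<le> \<omega> z"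
    and N: "N = luxemburg (young_ext (\<lambda>s. ennreal (\<Phi> s))) \<alpha> (grid_interval i) (\<lambda>z. ennreal (f z * \<omega> z))"
    and L: "L = luxemburg (young_ext (complementary \<Phi>)) \<alpha> (grid_interval i) (\<lambda>z. inverse (ennreal (\<omega> z)))"
    and fin: "N \<noteq> top" "L \<noteq> top"
  shows "(\<integral>\<^sup>+z\<in>grid_box i. ennreal (f z) \<partial>dV \<alpha>) \<le> ennreal (2 * grid_vol \<alpha> i) * (N * L)"
proof -
  define X where "X = (\<integral>\<^sup>+z\<in>grid_box i. ennreal (f z) \<partial>dV \<alpha>)"
  define V where "V = grid_vol \<alpha> i"
  have V: "V > 0" using grid_vol_pos[OF \<alpha>] by (simp add: V_def)
  have [measurable]: "f \<in> borel_measurable (dV \<alpha>)" "\<omega> \<in> borel_measurable (dV \<alpha>)"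
    using f \<omega> by (simp_all add: borel_measurable_dV)
  have step: "X \<le> ennreal (2 * V) * (ennreal \<kappa> * ennreal r)"
    if \<kappa>: "\<kappa> > 0" and r: "r > 0"
      and A\<kappa>: "ennreal (1 / V) * (\<integral>\<^sup>+z\<in>grid_box i. ennreal (\<Phi> (f z * \<omega> z / \<kappa>)) \<partial>dV \<alpha>) \<le> 1"
      and Ar: "ennreal (1 / V) * (\<integral>\<^sup>+z\<in>grid_box i. young_ext (complementary \<Phi>) (inverse (ennreal (\<omega> z)) / ennreal r) \<partial>dV \<alpha>) \<le> 1"
    for \<kappa> r
  proof -
    have clear: "I \<le> ennreal V" if "ennreal (1 / V) * I \<le> 1" for I
    proof -
      have "I = ennreal V * (ennreal (1 / V) * I)"
        using V by (simp add: mult.assoc[symmetric] ennreal_mult[symmetric])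
      also have "\<dots> \<le> ennreal V * 1" by (intro mult_left_mono that) simp
      finally show ?thesis by simp
    qed
    have [measurable]: "(\<lambda>z. \<Phi> (f z * \<omega> z / \<kappa>)) \<in> borel_measurable (dV \<alpha>)"
      using f \<omega> \<kappa> by (intro young_function_measurable[OF Y]) auto
    have "X \<le> (\<integral>\<^sup>+z. ennreal (\<kappa> * r) * (ennreal (\<Phi> (f z * \<omega> z / \<kappa>)) * indicator (grid_box i) z
        + young_ext (complementary \<Phi>) (inverse (ennreal (\<omega> z)) / ennreal r) * indicator (grid_box i) z) \<partial>dV \<alpha>)"
      unfolding X_def
    proof (rule nn_integral_mono)
      fix z
      have "ennreal (f z) \<le> ennreal (\<kappa> * r) * (ennreal (\<Phi> (f z * \<omega> z / \<kappa>)) +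
          young_ext (complementary \<Phi>) (inverse (ennreal (\<omega> z)) / ennreal r))"
      \<comment> \<open>At a zero of \<omega> the inverse is top, \<open>young_ext\<close> keeps it
        top, and the right side is infinite.\<close>
      proof (cases "\<omega> z = 0")
        case True
        then show ?thesis using \<kappa> r
          by (simp add: young_ext_def divide_ennreal_def ennreal_top_mult ennreal_mult_top inverse_ennreal)
      next
        case False
        then have w: "\<omega> z > 0" using \<omega>(2)[of z] by simp
        have "ennreal (f z) = ennreal (\<kappa> * r) * ennreal ((1 / \<omega> z / r) * (f z * \<omega> z / \<kappa>))"
          using w \<kappa> r f(2)[of z] by (simp add: ennreal_mult[symmetric])
        also have "\<dots> \<le> ennreal (\<kappa> * r) * (ennreal (\<Phi> (f z * \<omega> z / \<kappa>)) + complementary \<Phi> (1 / \<omega> z / r))"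
          using w \<kappa> r f(2)[of z] by (intro mult_left_mono young_inequality young_function_nonneg[OF Y]) auto
        also have "complementary \<Phi> (1 / \<omega> z / r) = young_ext (complementary \<Phi>) (inverse (ennreal (\<omega> z)) / ennreal r)"
          using w r by (simp add: inverse_ennreal divide_ennreal young_ext_def field_simps)
        finally show ?thesis .
      qed
      then show "ennreal (f z) * indicator (grid_box i) z \<le> ennreal (\<kappa> * r) * (ennreal (\<Phi> (f z * \<omega> z / \<kappa>)) * indicator (grid_box i) z
        + young_ext (complementary \<Phi>) (inverse (ennreal (\<omega> z)) / ennreal r) * indicator (grid_box i) z)"
        by (simp add: indicator_def)
    qed
    also have "\<dots> = ennreal (\<kappa> * r) * ((\<integral>\<^sup>+z\<in>grid_box i. ennreal (\<Phi> (f z * \<omega> z / \<kappa>)) \<partial>dV \<alpha>)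
        + (\<integral>\<^sup>+z\<in>grid_box i. young_ext (complementary \<Phi>) (inverse (ennreal (\<omega> z)) / ennreal r) \<partial>dV \<alpha>))"
      using grid_box_sets_dV[of i \<alpha>]
      by (subst nn_integral_cmult, simp del: sets_dV, subst nn_integral_add) (auto simp del: sets_dV)
    also have "\<dots> \<le> ennreal (\<kappa> * r) * (ennreal V + ennreal V)"
      by (intro mult_left_mono add_mono clear A\<kappa> Ar) auto
    also have "\<dots> = ennreal (2 * V) * (ennreal \<kappa> * ennreal r)"
      using V \<kappa> r by (simp add: ennreal_mult[symmetric] ennreal_plus[symmetric] mult.commute del: ennreal_plus)
    finally show ?thesis .
  qed
  \<comment> \<open>The infima are taken one at a time: over \<open>r\<close> with \<kappa> fixed,
    then over \<kappa>.\<close>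
  have "X \<le> ennreal (2 * V) * ennreal \<kappa> * L"
    if \<kappa>: "\<kappa> > 0" and A\<kappa>: "ennreal (1 / V) * (\<integral>\<^sup>+z\<in>grid_box i. ennreal (\<Phi> (f z * \<omega> z / \<kappa>)) \<partial>dV \<alpha>) \<le> 1" for \<kappa>
    unfolding L
  proof (rule le_mult_luxemburg)
    fix r :: real assume "0 < r" and "ennreal (1 / Qvol \<alpha> (grid_interval i)) *
         (\<integral>\<^sup>+z\<in>grid_box i. young_ext (complementary \<Phi>) (inverse (ennreal (\<omega> z)) / ennreal r) \<partial>dV \<alpha>) \<le> 1"
    then show "X \<le> ennreal (2 * V) * ennreal \<kappa> * ennreal r"
      using step[OF \<kappa> _ A\<kappa>, of r] by (simp add: Qvol_grid_interval[OF \<alpha>] V_def mult.assoc)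
  qed (use fin L in \<open>auto simp: ennreal_mult_eq_top_iff\<close>)
  then have R: "X \<le> ennreal (2 * V) * L * ennreal \<kappa>"
    if "\<kappa> > 0" "ennreal (1 / V) * (\<integral>\<^sup>+z\<in>grid_box i. ennreal (\<Phi> (f z * \<omega> z / \<kappa>)) \<partial>dV \<alpha>) \<le> 1" for \<kappa>
    using that by (simp add: ac_simps)
  have "X \<le> ennreal (2 * V) * L * N"
    unfolding N
  proof (rule le_mult_luxemburg)
    fix r :: real assume r: "0 < r" and "ennreal (1 / Qvol \<alpha> (grid_interval i)) *
         (\<integral>\<^sup>+z\<in>grid_box i. young_ext (\<lambda>s. ennreal (\<Phi> s)) (ennreal (f z * \<omega> z) / ennreal r) \<partial>dV \<alpha>) \<le> 1"
    then show "X \<le> ennreal (2 * V) * L * ennreal r"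
      using f \<omega> by (intro R) (simp_all add: Qvol_grid_interval[OF \<alpha>] V_def young_ext_ennreal_divide)
  qed (use fin N in \<open>auto simp: ennreal_mult_eq_top_iff\<close>)
  then have "X \<le> ennreal (2 * V) * (N * L)" by (simp add: ac_simps)
  then show ?thesis unfolding X_def V_def .
qed

section \<open>The two-weight inequality\<close>

text \<open>The covering grid interval is at most four times as long as \<open>I\<close> and the
  exponent of the length is negative, which costs \<open>4 powr (2 + \<alpha> - \<gamma>)\<close>.
  Each term then lies below the q-th root of the sum of q-th powers, and so does the
  supremum.\<close>

lemma frac_max_powr_le:
  assumes q: "0 < q" and \<gamma>: "\<gamma> < 2 + \<alpha>"
  shows "enn_powr (frac_max \<alpha> \<gamma> f z) q \<le>
    (\<integral>\<^sup>+i. enn_powr (ennreal (4 powr (2 + \<alpha> - \<gamma>) * ilen (grid_interval i) powr (-(2 + \<alpha> - \<gamma>))) *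
        (\<integral>\<^sup>+w\<in>grid_box i. ennreal (cmod (f w)) \<partial>dV \<alpha>)) q * indicator (grid_box i) z \<partial>count_space UNIV)"
    (is "_ \<le> nn_integral _ (\<lambda>i. enn_powr (?m i) q * _)")
proof -
  define T where "T = (\<integral>\<^sup>+i. enn_powr (?m i) q * indicator (grid_box i) z \<partial>count_space UNIV)"
  have "frac_max \<alpha> \<gamma> f z \<le> enn_powr T (1 / q)"
    unfolding frac_max_def
  proof (rule SUP_least, clarify)
    fix I assume I: "is_real_interval I" "z \<in> Qbox I"
    obtain i where i: "I \<subseteq> grid_interval i" "ilen I \<le> ilen (grid_interval i)"
      "ilen (grid_interval i) \<le> 4 * ilen I" "0 < ilen I"
      using grid_interval_covers[OF I(1)] .
    have sub: "Qbox I \<subseteq> grid_box i" using i by (intro Qbox_mono)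
    have "ilen I powr (-(2 + \<alpha> - \<gamma>)) \<le> (ilen (grid_interval i) / 4) powr (-(2 + \<alpha> - \<gamma>))"
      using i \<gamma> by (intro powr_mono2') auto
    also have "\<dots> = 4 powr (2 + \<alpha> - \<gamma>) * ilen (grid_interval i) powr (-(2 + \<alpha> - \<gamma>))"
      using i by (simp add: powr_divide powr_minus field_simps powr_diff powr_add)
    finally have "ennreal (ilen I powr (-(2 + \<alpha> - \<gamma>))) * (\<integral>\<^sup>+w\<in>Qbox I. ennreal (cmod (f w)) \<partial>dV \<alpha>) \<le> ?m i"
      using sub by (intro mult_mono ennreal_leI nn_integral_mono) (auto simp: indicator_def)
    also have "?m i = enn_powr (enn_powr (?m i) q * indicator (grid_box i) z) (1 / q)"
      using q sub I by (auto simp: enn_powr_powr)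
    also have "\<dots> \<le> enn_powr T (1 / q)"
      unfolding T_def using q
      by (intro enn_powr_mono nn_integral_ge_point[where p = "\<lambda>i. enn_powr (?m i) q * indicator (grid_box i) z"]) auto
    finally show "ennreal (ilen I powr (-(2 + \<alpha> - \<gamma>))) * (\<integral>\<^sup>+w\<in>Qbox I. ennreal (cmod (f w)) \<partial>dV \<alpha>)
      \<le> enn_powr T (1 / q)" .
  qed
  then have "enn_powr (frac_max \<alpha> \<gamma> f z) q \<le> enn_powr (enn_powr T (1 / q)) q"
    using q by (intro enn_powr_mono) auto
  then show ?thesis using q by (simp add: enn_powr_powr T_def)
qed

text \<open>With d the side of the box, the volume is d^(2+\<alpha>)/(1+\<alpha>), and both sides
  equal d^\<gamma>/(1+\<alpha>).\<close>

lemma ilen_grid_interval_powr: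
  assumes \<alpha>: "\<alpha> > -1"
  shows "ilen (grid_interval i) powr (-(2 + \<alpha> - \<gamma>)) * grid_vol \<alpha> i
    = (1 + \<alpha>) powr (\<gamma> / (2 + \<alpha>) - 1) * grid_vol \<alpha> i powr (\<gamma> / (2 + \<alpha>))"
proof -
  define d where "d = ilen (grid_interval i)"
  have d: "d > 0" by (simp add: d_def ilen_grid_interval)
  have V: "grid_vol \<alpha> i = d powr (2 + \<alpha>) / (1 + \<alpha>)"
    by (simp add: grid_vol_def d_def ilen_grid_interval powr_powr)
  have "d powr (-(2 + \<alpha> - \<gamma>)) * d powr (2 + \<alpha>) = d powr \<gamma>"
    by (simp add: powr_add[symmetric])
  moreover have "(d powr (2 + \<alpha>)) powr (\<gamma> / (2 + \<alpha>)) = d powr \<gamma>"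
    using \<alpha> by (simp add: powr_powr)
  ultimately show ?thesis
    unfolding d_def[symmetric] V using \<alpha> d by (simp add: powr_divide powr_diff)
qed

text \<open>With \<theta> = \<gamma>/(2+\<alpha>) and V the volume, V^(q \<theta>) splits into
  V^(q/p) and V^(q(\<theta> - 1/p)). The second factor joins L^q and m to form the testing quantity;
  the first joins N^q to form (V N^p)^(q/p). In \<open>b\<close>, the 2 comes from Hoelder, the
  power of 4 from the comparison with grid intervals, and the power of 1 + \<alpha> from the
  normalisation of the volume.\<close>

lemma testing_term_bound:
  assumes \<alpha>: "\<alpha> > -1" and p: "0 < p" and q: "0 < q" and C: "0 < C"
    and X: "X \<le> ennreal (2 * grid_vol \<alpha> i) * (N * L)"
    and test: "ennreal (grid_vol \<alpha> i powr (q * (\<gamma> / (2 + \<alpha>) - 1 / p))) * enn_powr L q * m \<le> ennreal C"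
    and b: "b = 2 * 4 powr (2 + \<alpha> - \<gamma>) * (1 + \<alpha>) powr (\<gamma> / (2 + \<alpha>) - 1)"
  shows "enn_powr (ennreal (4 powr (2 + \<alpha> - \<gamma>) * ilen (grid_interval i) powr (-(2 + \<alpha> - \<gamma>))) * X) q * m
    \<le> ennreal (b powr q * C) * enn_powr (ennreal (grid_vol \<alpha> i) * enn_powr N p) (q / p)"
proof -
  define V where "V = grid_vol \<alpha> i"
  define \<theta> where "\<theta> = \<gamma> / (2 + \<alpha>)"
  define a where "a = 4 powr (2 + \<alpha> - \<gamma>) * ilen (grid_interval i) powr (-(2 + \<alpha> - \<gamma>))"
  have V: "V > 0" using grid_vol_pos[OF \<alpha>] by (simp add: V_def)
  have a0: "a \<ge> 0" by (simp add: a_def)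
  have b0: "b \<ge> 0" by (simp add: b)
  have "a * (2 * V) = 2 * 4 powr (2 + \<alpha> - \<gamma>) * (ilen (grid_interval i) powr (-(2 + \<alpha> - \<gamma>)) * grid_vol \<alpha> i)"
    by (simp add: a_def V_def)
  then have aV: "a * (2 * V) = b * V powr \<theta>"
    unfolding ilen_grid_interval_powr[OF \<alpha>] b by (simp add: V_def \<theta>_def)
  have "(b * V powr \<theta>) powr q = b powr q * V powr (q / p + q * (\<theta> - 1 / p))"
    using V b0 by (simp add: powr_mult powr_powr algebra_simps)
  then have abq: "(b * V powr \<theta>) powr q = b powr q * V powr (q / p) * V powr (q * (\<theta> - 1 / p))"
    by (simp add: powr_add)
  have split: "enn_powr (ennreal (b * V powr \<theta>)) q =
      ennreal (b powr q * V powr (q / p)) * ennreal (V powr (q * (\<theta> - 1 / p)))"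
    using b0 by (subst enn_powr_ennreal) (auto simp: abq ennreal_mult)
  have "enn_powr (ennreal a * X) q * m \<le> enn_powr (ennreal (b * V powr \<theta>) * N * L) q * m"
  proof (intro mult_right_mono enn_powr_mono)
    have "ennreal a * X \<le> ennreal a * (ennreal (2 * V) * (N * L))"
      using X by (intro mult_left_mono) (auto simp: V_def)
    also have "\<dots> = ennreal (b * V powr \<theta>) * N * L"
      using a0 V by (simp add: aV[symmetric] ennreal_mult ac_simps)
    finally show "ennreal a * X \<le> ennreal (b * V powr \<theta>) * N * L" .
  qed (use q in auto)
  also have "\<dots> = ennreal (b powr q * V powr (q / p)) * enn_powr N q *
      (ennreal (V powr (q * (\<theta> - 1 / p))) * enn_powr L q * m)"
    unfolding enn_powr_mult split by (simp only: ac_simps)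
  also have "\<dots> \<le> ennreal (b powr q * V powr (q / p)) * enn_powr N q * ennreal C"
    using test by (intro mult_left_mono) (auto simp: V_def \<theta>_def)
  also have "\<dots> = ennreal (b powr q * C) * enn_powr (ennreal V * enn_powr N p) (q / p)"
    using V C p by (simp add: enn_powr_mult enn_powr_powr enn_powr_ennreal ennreal_mult ac_simps)
  finally show ?thesis by (simp add: a_def V_def)
qed

lemma two_weight_bound:
  fixes \<omega> :: "complex \<Rightarrow> real" and \<mu> :: "complex measure"
  assumes \<alpha>: "\<alpha> > -1" and p: "1 < p" and pq: "p \<le> q" and \<gamma>: "\<gamma> < 2 + \<alpha>"
    and Bp: "Bp_class p \<Phi>"
    and \<omega>: "\<omega> \<in> borel_measurable lebesgue" "\<And>z. 0 \<le> \<omega> z"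
    and \<mu>: "sets \<mu> = sets borel" and C: "C > 0"
    and test: "\<And>i. ennreal (grid_vol \<alpha> i powr (q * (\<gamma> / (2 + \<alpha>) - 1 / p)))
          * enn_powr (luxemburg (young_ext (complementary \<Phi>)) \<alpha> (grid_interval i) (\<lambda>z. inverse (ennreal (\<omega> z)))) q
          * emeasure \<mu> (grid_box i) \<le> ennreal C"
  obtains K where "K > 0" "\<And>f :: complex \<Rightarrow> complex. f \<in> borel_measurable lebesgue \<Longrightarrow>
     enn_powr (\<integral>\<^sup>+z\<in>UHP. enn_powr (frac_max \<alpha> \<gamma> f z) q \<partial>\<mu>) (1 / q)
      \<le> ennreal K * enn_powr (\<integral>\<^sup>+z\<in>UHP. ennreal ((cmod (f z) * \<omega> z) powr p) \<partial>dV \<alpha>) (1 / p)"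
proof -
  have Y: "young_function \<Phi>" using Bp by (simp add: Bp_class_def)
  have p0: "p > 0" and q0: "q > 0" using p pq by auto
  obtain E where E: "E > 0" and embed:
    "\<And>g. g \<in> borel_measurable lebesgue \<Longrightarrow> (\<And>z. 0 \<le> g z) \<Longrightarrow>
      (\<integral>\<^sup>+i. ennreal (grid_vol \<alpha> i) *
          enn_powr (luxemburg (young_ext (\<lambda>s. ennreal (\<Phi> s))) \<alpha> (grid_interval i) (\<lambda>z. ennreal (g z))) p
        \<partial>count_space UNIV) \<le> ennreal E * (\<integral>\<^sup>+z\<in>UHP. ennreal (g z powr p) \<partial>dV \<alpha>)"
    using luxemburg_embedding[OF \<alpha> p0 Bp] by blast
  define b where "b = 2 * 4 powr (2 + \<alpha> - \<gamma>) * (1 + \<alpha>) powr (\<gamma> / (2 + \<alpha>) - 1)"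
  define D where "D = b powr q * C"
  \<comment> \<open>What remains of D (E R)^(q/p) after the q-th root, apart from R^(1/p).\<close>
  define K where "K = D powr (1 / q) * E powr (1 / p)"
  have b0: "b > 0" using \<alpha> by (simp add: b_def)
  have D0: "D > 0" using b0 C by (simp add: D_def)
  have K0: "K > 0" using D0 E by (simp add: K_def)
  have [measurable]: "grid_box i \<in> sets \<mu>" for i
    using borel_measurable_Qbox[OF grid_interval_borel] \<mu> by simp
  have "enn_powr (\<integral>\<^sup>+z\<in>UHP. enn_powr (frac_max \<alpha> \<gamma> f z) q \<partial>\<mu>) (1 / q)
      \<le> ennreal K * enn_powr (\<integral>\<^sup>+z\<in>UHP. ennreal ((cmod (f z) * \<omega> z) powr p) \<partial>dV \<alpha>) (1 / p)"
    if f: "f \<in> borel_measurable lebesgue" for f :: "complex \<Rightarrow> complex"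
  proof -
    define R where "R = (\<integral>\<^sup>+z\<in>UHP. ennreal ((cmod (f z) * \<omega> z) powr p) \<partial>dV \<alpha>)"
    show ?thesis
    proof (cases "R = top")
      case True
      then show ?thesis using K0 by (simp add: R_def[symmetric] ennreal_mult_top)
    next
      case False
      define N where "N i = luxemburg (young_ext (\<lambda>s. ennreal (\<Phi> s))) \<alpha> (grid_interval i)
         (\<lambda>z. ennreal (cmod (f z) * \<omega> z))" for i
      define L where "L i = luxemburg (young_ext (complementary \<Phi>)) \<alpha> (grid_interval i)
         (\<lambda>z. inverse (ennreal (\<omega> z)))" for i
      define X where "X i = (\<integral>\<^sup>+z\<in>grid_box i. ennreal (cmod (f z)) \<partial>dV \<alpha>)" for i
      define a where "a i = enn_powr (ennreal (4 powr (2 + \<alpha> - \<gamma>) * ilen (grid_interval i) powr (-(2 + \<alpha> - \<gamma>))) * X i) q" for i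
      have cf: "(\<lambda>z. cmod (f z)) \<in> borel_measurable lebesgue" using f by measurable
      have sumN: "(\<integral>\<^sup>+i. ennreal (grid_vol \<alpha> i) * enn_powr (N i) p \<partial>count_space UNIV) \<le> ennreal E * R"
        unfolding N_def R_def using cf \<omega> by (intro embed borel_measurable_times) auto
      \<comment> \<open>The volumes are positive, so one infinite norm would make the finite
        embedding sum infinite.\<close>
      have Nfin: "N i \<noteq> top" for i
      proof
        assume "N i = top"
        then have "top = ennreal (grid_vol \<alpha> i) * enn_powr (N i) p"
          using grid_vol_pos[OF \<alpha>, of i] by (simp add: ennreal_mult_top)
        also have "\<dots> \<le> (\<integral>\<^sup>+i. ennreal (grid_vol \<alpha> i) * enn_powr (N i) p \<partial>count_space UNIV)"
          by (rule nn_integral_ge_point) simp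
        also note sumN
        finally show False using False by (auto simp: top_unique ennreal_mult_eq_top_iff)
      qed
      have term_le: "a i * emeasure \<mu> (grid_box i) \<le> ennreal D * enn_powr (ennreal (grid_vol \<alpha> i) * enn_powr (N i) p) (q / p)" for i
      \<comment> \<open>An infinite dual norm is compatible with the testing condition only on a box
        of \<mu>-measure 0, where the term vanishes.\<close>
      proof (cases "L i = top")
        case True
        have "emeasure \<mu> (grid_box i) = 0"
        proof (rule ccontr)
          assume "emeasure \<mu> (grid_box i) \<noteq> 0"
          then show False using test[of i] True grid_vol_pos[OF \<alpha>, of i]
            by (simp add: L_def[symmetric] ennreal_mult_top ennreal_top_mult top_unique)
        qed
        then show ?thesis by simp
      next
        case False
        have "X i \<le> ennreal (2 * grid_vol \<alpha> i) * (N i * L i)"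
          unfolding X_def using Nfin False
          by (intro orlicz_hoelder[OF \<alpha> Y cf _ \<omega>]) (auto simp: N_def L_def)
        from testing_term_bound[OF \<alpha> p0 q0 C this _ b_def] test[of i] show ?thesis
          unfolding a_def D_def L_def by blast
      qed
      \<comment> \<open>The maximal function enters only through monotonicity of the integral;
        Tonelli is applied to its majorant, a countable sum of constants times indicators of Borel
        boxes.\<close>
      have "(\<integral>\<^sup>+z\<in>UHP. enn_powr (frac_max \<alpha> \<gamma> f z) q \<partial>\<mu>)
          \<le> (\<integral>\<^sup>+z. \<integral>\<^sup>+i. a i * indicator (grid_box i) z \<partial>count_space UNIV \<partial>\<mu>)"
        unfolding a_def X_def
        using frac_max_powr_le[OF q0 \<gamma>] by (intro nn_integral_mono) (auto simp: indicator_def[of UHP])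
      also have "\<dots> = (\<integral>\<^sup>+i. \<integral>\<^sup>+z. a i * indicator (grid_box i) z \<partial>\<mu> \<partial>count_space UNIV)"
        by (rule nn_integral_count_space_nn_integral) auto
      also have "\<dots> = (\<integral>\<^sup>+i. a i * emeasure \<mu> (grid_box i) \<partial>count_space UNIV)"
        by (simp add: nn_integral_cmult_indicator)
      also have "\<dots> \<le> (\<integral>\<^sup>+i. ennreal D * enn_powr (ennreal (grid_vol \<alpha> i) * enn_powr (N i) p) (q / p) \<partial>count_space UNIV)"
        by (intro nn_integral_mono term_le)
      also have "\<dots> \<le> ennreal D * enn_powr (\<integral>\<^sup>+i. ennreal (grid_vol \<alpha> i) * enn_powr (N i) p \<partial>count_space UNIV) (q / p)"
        using p pq by (subst nn_integral_cmult) (auto intro!: mult_left_mono nn_integral_count_space_powr_le)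
      also have "\<dots> \<le> ennreal D * enn_powr (ennreal E * R) (q / p)"
        using sumN p0 q0 by (intro mult_left_mono enn_powr_mono) auto
      finally have "enn_powr (\<integral>\<^sup>+z\<in>UHP. enn_powr (frac_max \<alpha> \<gamma> f z) q \<partial>\<mu>) (1 / q)
          \<le> enn_powr (ennreal D * enn_powr (ennreal E * R) (q / p)) (1 / q)"
        using q0 by (intro enn_powr_mono) auto
      also have "\<dots> = ennreal K * enn_powr R (1 / p)"
        using q0 p0 D0 E by (simp add: enn_powr_mult enn_powr_powr enn_powr_ennreal powr_powr K_def ennreal_mult ac_simps)
      finally show ?thesis by (simp add: R_def)
    qed
  qed
  then show thesis using K0 that by blast
qed

text \<open>A weight is known to be integrable only on compact subsets of \<open>UHP\<close>.
  Compact rectangles \<open>S n\<close> exhaust the half-plane, and the restricted weight is the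
  pointwise limit of its restrictions to them.\<close>

lemma weight_restrict_measurable:
  assumes "weight \<omega>"
  shows "(\<lambda>z. indicator UHP z * \<omega> z) \<in> borel_measurable lebesgue"
proof -
  define S where "S n = {z. \<bar>Re z\<bar> \<le> real n \<and> 1 / Suc n \<le> Im z \<and> Im z \<le> real n}" for n
  have S: "compact (S n)" "S n \<subseteq> UHP" for n
  proof -
    have eq: "S n = cbox (Complex (- real n) (1 / Suc n)) (Complex (real n) (real n))"
      by (auto simp: S_def in_cbox_complex_iff)
    show "compact (S n)" unfolding eq by simp
    show "S n \<subseteq> UHP"
      unfolding S_def UHP_def by (auto intro: less_le_trans[of 0 "1 / (1 + real n)"])
  qed
  have "(\<lambda>z. indicator (S n) z * \<omega> z) \<in> borel_measurable lebesgue" for n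
    using assms S[of n] unfolding weight_def set_integrable_def
    by (auto dest!: spec[of _ "S n"] borel_measurable_integrable)
  moreover have "(\<lambda>n. indicator (S n) z * \<omega> z) \<longlonglongrightarrow> indicator UHP z * \<omega> z" for z
  proof (cases "z \<in> UHP")
    case True
    then have z: "Im z > 0" by (simp add: UHP_def)
    obtain n0 where n0: "inverse (Suc n0) < Im z" using reals_Archimedean[OF z] by auto
    obtain n1 where n1: "max \<bar>Re z\<bar> (Im z) \<le> real n1" using real_arch_simple by blast
    have "z \<in> S n" if "n \<ge> max n0 n1" for n
    proof -
      have "inverse (real (Suc n)) \<le> inverse (Suc n0)" using that by (intro le_imp_inverse_le) auto
      then show ?thesis using that n0 n1 by (auto simp: S_def inverse_eq_divide)
    qed
    then have "\<forall>\<^sub>F n in sequentially. indicator (S n) z * \<omega> z = indicator UHP z * \<omega> z"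
      using True by (intro eventually_sequentiallyI[of "max n0 n1"]) auto
    then show ?thesis by (rule tendsto_eventually)
  next
    case False
    then have "z \<notin> S n" for n using S(2) by blast
    then show ?thesis using False by simp
  qed
  ultimately show ?thesis by (rule borel_measurable_LIMSEQ_real[rotated])
qed

theorem theorem2p6:
  fixes \<alpha> p q \<gamma> C :: real and \<Phi> :: "real \<Rightarrow> real" and \<omega> :: "complex \<Rightarrow> real"
    and \<mu> :: "complex measure"
  assumes "\<alpha> > -1" and "1 < p" and "p \<le> q"
    and "0 \<le> \<gamma>" and "\<gamma> < 2 + \<alpha>"
    and "Bp_class p \<Phi>"
    and "weight \<omega>"
    and "sets \<mu> = sets borel"
    and "C > 0"
    and "\<forall>I. is_real_interval I \<longrightarrow>
          ennreal (Qvol \<alpha> I powr (q * (\<gamma> / (2 + \<alpha>) - 1 / p)))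
          * enn_powr (luxemburg (young_ext (complementary \<Phi>)) \<alpha> I (\<lambda>z. inverse (ennreal (\<omega> z)))) q
          * emeasure \<mu> (Qbox I) \<le> ennreal C"
  shows "\<exists>K>0. \<forall>f :: complex \<Rightarrow> complex.
           f \<in> borel_measurable lebesgue \<and>
           set_nn_integral (dV \<alpha>) UHP (\<lambda>z. ennreal (cmod (f z) powr p * \<omega> z)) < \<infinity> \<longrightarrow>
           enn_powr (set_nn_integral \<mu> UHP (\<lambda>z. enn_powr (frac_max \<alpha> \<gamma> f z) q)) (1 / q)
           \<le> ennreal K * enn_powr (set_nn_integral (dV \<alpha>) UHP (\<lambda>z. ennreal ((cmod (f z) * \<omega> z) powr p))) (1 / p)"
proof -
  \<comment> \<open>The estimates require a weight measurable on all of the plane, while \<omega> is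
    arbitrary off \<open>UHP\<close>. Cutting it to 0 there changes none of the integrals, since all
    of them are taken inside \<open>UHP\<close>.\<close>
  define W where "W z = indicator UHP z * \<omega> z" for z
  have W: "W \<in> borel_measurable lebesgue" "0 \<le> W z" for z
    using weight_restrict_measurable[OF \<open>weight \<omega>\<close>] \<open>weight \<omega>\<close>
    by (auto simp: W_def[abs_def] weight_def)
  have W_eq: "W z = \<omega> z" if "z \<in> UHP" for z using that by (simp add: W_def)
  have lux: "luxemburg (young_ext (complementary \<Phi>)) \<alpha> (grid_interval i) (\<lambda>z. inverse (ennreal (\<omega> z)))
      = luxemburg (young_ext (complementary \<Phi>)) \<alpha> (grid_interval i) (\<lambda>z. inverse (ennreal (W z)))" for i
  proof -
    have "(\<integral>\<^sup>+z\<in>grid_box i. young_ext (complementary \<Phi>) (inverse (ennreal (\<omega> z)) / ennreal r) \<partial>dV \<alpha>)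
       = (\<integral>\<^sup>+z\<in>grid_box i. young_ext (complementary \<Phi>) (inverse (ennreal (W z)) / ennreal r) \<partial>dV \<alpha>)" for r
      using W_eq grid_box_subset_UHP[of i] by (intro nn_integral_cong) (auto simp: indicator_def)
    then show ?thesis unfolding luxemburg_def by simp
  qed
  have "ennreal (grid_vol \<alpha> i powr (q * (\<gamma> / (2 + \<alpha>) - 1 / p)))
          * enn_powr (luxemburg (young_ext (complementary \<Phi>)) \<alpha> (grid_interval i) (\<lambda>z. inverse (ennreal (W z)))) q
          * emeasure \<mu> (grid_box i) \<le> ennreal C" for i
    using assms(10) is_real_interval_grid_interval[of i] Qvol_grid_interval[OF \<open>\<alpha> > -1\<close>, of i]
    by (metis lux)
  then obtain K where K: "K > 0" "\<And>f :: complex \<Rightarrow> complex. f \<in> borel_measurable lebesgue \<Longrightarrow>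
     enn_powr (\<integral>\<^sup>+z\<in>UHP. enn_powr (frac_max \<alpha> \<gamma> f z) q \<partial>\<mu>) (1 / q)
      \<le> ennreal K * enn_powr (\<integral>\<^sup>+z\<in>UHP. ennreal ((cmod (f z) * W z) powr p) \<partial>dV \<alpha>) (1 / p)"
    using two_weight_bound[OF assms(1-3,5,6) W assms(8,9)] by blast
  have "(\<integral>\<^sup>+z\<in>UHP. ennreal ((cmod (f z) * W z) powr p) \<partial>dV \<alpha>)
      = (\<integral>\<^sup>+z\<in>UHP. ennreal ((cmod (f z) * \<omega> z) powr p) \<partial>dV \<alpha>)" for f :: "complex \<Rightarrow> complex"
    by (intro nn_integral_cong) (auto simp: indicator_def W_eq)
  with K show ?thesis by (intro exI[of _ K]) simp
qed

end
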